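(* Let $N\in\mathbb{N}$, $N\ge 1$, and let $\varphi\in H^\infty(\mathbb{T}^N)$. Let $M_\varphi:H^2(\mathbb{T}^N)\to H^2(\mathbb{T}^N)$ be the multiplication operator $M_\varphi f=\varphi f$. The following are equivalent. (i) $M_\varphi$ admits a Parseval frame of orbits, i.e. there exists a countable family $\{f_i\}_{i\in I}\subseteq H^2(\mathbb{T}^N)$ such that $\{M_\varphi^n f_i\}_{i\in I,\,n\ge 0}$ is a Parseval frame for $H^2(\mathbb{T}^N)$. (ii) $M_\varphi$ admits a frame of orbits, i.e. there exists a countable family $\{f_i\}_{i\in I}\subseteq H^2(\mathbb{T}^N)$ such that $\{M_\varphi^n f_i\}_{i\in I,\,n\ge 0}$ is a frame for $H^2(\mathbb{T}^N)$. (iii) $\|\varphi\|_\infty\le 1$ and $|\widehat{\varphi}(0)|<1$.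
   Context: $\mathbb{T}^N=\{\zeta\in\mathbb{C}^N: |\zeta_j|=1 \text{ for all } j\}$ carries its normalized Haar (Lebesgue) measure $d\zeta$. For $f\in L^2(\mathbb{T}^N)$ and $\alpha\in\mathbb{Z}^N$, $\widehat f(\alpha)=\int_{\mathbb{T}^N} f(\zeta)\zeta^{-\alpha}\,d\zeta$, where $\zeta^\alpha=\zeta_1^{\alpha_1}\cdots\zeta_N^{\alpha_N}$. $H^2(\mathbb{T}^N)$ is the closed subspace of $L^2(\mathbb{T}^N)$ of those $f$ with $\widehat f(\alpha)=0$ for all $\alpha\in\mathbb{Z}^N\setminus\mathbb{N}_0^N$, and $H^\infty(\mathbb{T}^N)=L^\infty(\mathbb{T}^N)\cap H^2(\mathbb{T}^N)$ with the essential supremum norm $\|\cdot\|_\infty$. A countable family $\{x_j\}_{j\in\Omega}$ in a Hilbert space $\mathcal{H}$ is a frame for $\mathcal{H}$ if there are constants $A,B>0$ with $A\|y\|^2\le\sum_{j\in\Omega}|\langle y,x_j\rangle|^2\le B\|y\|^2$ for all $y\in\mathcal{H}$; it is a Parseval frame if one can take $A=B=1$. *)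

theory Defs
  imports "HOL-Probability.Probability"
begin

section \<open>The torus and its Haar measure\<close>

text \<open>
  The \<open>N\<close>-torus is modelled by the extensional functions from \<open>{..<N}\<close> to the unit circle;
  this is the space of the measure \<open>torus N\<close>.
\<close>

definition circle :: "complex measure" where
  "circle = distr (uniform_measure lborel {0..2 * pi}) (restrict_space borel (sphere 0 1)) cis"

definition torus :: "nat \<Rightarrow> (nat \<Rightarrow> complex) measure" where
  "torus N = (\<Pi>\<^sub>M j\<in>{..<N}. circle)"

text \<open>Multi-indices are functions \<open>nat \<Rightarrow> int\<close> of which only the values below \<open>N\<close> matter.\<close>

definition monomial :: "nat \<Rightarrow> (nat \<Rightarrow> int) \<Rightarrow> (nat \<Rightarrow> complex) \<Rightarrow> complex" where
  "monomial N \<alpha> \<zeta> = (\<Prod>j<N. \<zeta> j powi \<alpha> j)"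

definition fourier_coeff ::
    "nat \<Rightarrow> ((nat \<Rightarrow> complex) \<Rightarrow> complex) \<Rightarrow> (nat \<Rightarrow> int) \<Rightarrow> complex" where
  "fourier_coeff N f \<alpha> = (LINT \<zeta>|torus N. f \<zeta> * monomial N (\<lambda>j. - \<alpha> j) \<zeta>)"


section \<open>Lebesgue and Hardy spaces\<close>

text \<open>
  Elements of these spaces are represented by functions, not by classes modulo equality almost
  everywhere. Hence \<open>L2_inner\<close> is only positive semidefinite on representatives; all notions
  below are invariant under changes on null sets.
\<close>

definition L2 :: "nat \<Rightarrow> ((nat \<Rightarrow> complex) \<Rightarrow> complex) set" where
  "L2 N = {f \<in> borel_measurable (torus N). integrable (torus N) (\<lambda>\<zeta>. (cmod (f \<zeta>))\<^sup>2)}"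

definition L2_inner ::
    "nat \<Rightarrow> ((nat \<Rightarrow> complex) \<Rightarrow> complex) \<Rightarrow> ((nat \<Rightarrow> complex) \<Rightarrow> complex) \<Rightarrow> complex" where
  "L2_inner N f g = (LINT \<zeta>|torus N. f \<zeta> * cnj (g \<zeta>))"

definition Linf_norm :: "nat \<Rightarrow> ((nat \<Rightarrow> complex) \<Rightarrow> complex) \<Rightarrow> ereal" where
  "Linf_norm N f = esssup (torus N) (\<lambda>\<zeta>. ereal (cmod (f \<zeta>)))"

definition Linf :: "nat \<Rightarrow> ((nat \<Rightarrow> complex) \<Rightarrow> complex) set" where
  "Linf N = {f \<in> borel_measurable (torus N). Linf_norm N f < \<infinity>}"

definition H2 :: "nat \<Rightarrow> ((nat \<Rightarrow> complex) \<Rightarrow> complex) set" where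
  "H2 N = {f \<in> L2 N. \<forall>\<alpha>. \<not> (\<forall>j<N. 0 \<le> \<alpha> j) \<longrightarrow> fourier_coeff N f \<alpha> = 0}"

definition Hinf :: "nat \<Rightarrow> ((nat \<Rightarrow> complex) \<Rightarrow> complex) set" where
  "Hinf N = Linf N \<inter> H2 N"

definition mult_op ::
    "((nat \<Rightarrow> complex) \<Rightarrow> complex) \<Rightarrow> ((nat \<Rightarrow> complex) \<Rightarrow> complex) \<Rightarrow> (nat \<Rightarrow> complex) \<Rightarrow> complex" where
  "mult_op \<phi> f = (\<lambda>\<zeta>. \<phi> \<zeta> * f \<zeta>)"


section \<open>Frames\<close>

text \<open>
  The Hilbert space is given by its carrier \<open>H\<close> and its inner product \<open>ip\<close>, so that
  \<open>Re (ip y y)\<close> is the squared norm. Summability is required explicitly, since \<open>infsum\<close>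
  takes the value 0 on families that are not summable.
\<close>

definition frame_with_bounds ::
    "'v set \<Rightarrow> ('v \<Rightarrow> 'v \<Rightarrow> complex) \<Rightarrow> real \<Rightarrow> real \<Rightarrow> 'j set \<Rightarrow> ('j \<Rightarrow> 'v) \<Rightarrow> bool" where
  "frame_with_bounds H ip A B \<Omega> x \<longleftrightarrow>
     countable \<Omega> \<and> (\<forall>j\<in>\<Omega>. x j \<in> H) \<and>
     (\<forall>y\<in>H. (\<lambda>j. (cmod (ip y (x j)))\<^sup>2) summable_on \<Omega> \<and>
        A * Re (ip y y) \<le> (\<Sum>\<^sub>\<infinity>j\<in>\<Omega>. (cmod (ip y (x j)))\<^sup>2) \<and>
        (\<Sum>\<^sub>\<infinity>j\<in>\<Omega>. (cmod (ip y (x j)))\<^sup>2) \<le> B * Re (ip y y))"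

definition is_frame ::
    "'v set \<Rightarrow> ('v \<Rightarrow> 'v \<Rightarrow> complex) \<Rightarrow> 'j set \<Rightarrow> ('j \<Rightarrow> 'v) \<Rightarrow> bool" where
  "is_frame H ip \<Omega> x \<longleftrightarrow> (\<exists>A>0. \<exists>B>0. frame_with_bounds H ip A B \<Omega> x)"

definition is_parseval_frame ::
    "'v set \<Rightarrow> ('v \<Rightarrow> 'v \<Rightarrow> complex) \<Rightarrow> 'j set \<Rightarrow> ('j \<Rightarrow> 'v) \<Rightarrow> bool" where
  "is_parseval_frame H ip \<Omega> x \<longleftrightarrow> frame_with_bounds H ip 1 1 \<Omega> x"

text \<open>Every countable index set is in bijection with a set of natural numbers.\<close>

definition admits_frame_of_orbits ::
    "'v set \<Rightarrow> ('v \<Rightarrow> 'v \<Rightarrow> complex) \<Rightarrow> ('v \<Rightarrow> 'v) \<Rightarrow> bool" where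
  "admits_frame_of_orbits H ip T \<longleftrightarrow>
     (\<exists>(I :: nat set) f. (\<forall>i\<in>I. f i \<in> H) \<and>
        is_frame H ip (I \<times> (UNIV :: nat set)) (\<lambda>(i, n). (T ^^ n) (f i)))"

definition admits_parseval_frame_of_orbits ::
    "'v set \<Rightarrow> ('v \<Rightarrow> 'v \<Rightarrow> complex) \<Rightarrow> ('v \<Rightarrow> 'v) \<Rightarrow> bool" where
  "admits_parseval_frame_of_orbits H ip T \<longleftrightarrow>
     (\<exists>(I :: nat set) f. (\<forall>i\<in>I. f i \<in> H) \<and>
        is_parseval_frame H ip (I \<times> (UNIV :: nat set)) (\<lambda>(i, n). (T ^^ n) (f i)))"

end

theory Submission
  imports Defs
begin

text \<open>
  Write \<open>T\<close> for multiplication by \<open>\<phi>\<close> on the Hardy space, \<open>T\<^sup>*\<close> for its adjoint and \<open>c\<close> for the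
  constant Fourier coefficient of \<open>\<phi>\<close>. Everything rests on the identity
  \<open>\<langle>y, T\<^sup>n f\<rangle> = \<langle>T\<^sup>*\<^sup>n y, f\<rangle>\<close>, which expresses frame sums of orbits through the powers of \<open>T\<^sup>*\<close>.

  Suppose that the orbits form a frame with bounds \<open>A\<close> and \<open>B\<close>. Replacing \<open>y\<close> by \<open>T\<^sup>*\<^sup>n y\<close> merely drops terms
  from the frame sum, so \<open>A * \<parallel>T\<^sup>*\<^sup>n y\<parallel>\<^sup>2 \<le> B * \<parallel>y\<parallel>\<^sup>2\<close>. For \<open>y = \<phi>\<^sup>n\<close> this bounds the integrals of
  \<open>\<bar>\<phi>\<bar>\<close> to the power \<open>2 * n\<close> uniformly in \<open>n\<close> (\<open>frame_of_orbits_power_bound\<close>), which forces \<open>\<bar>\<phi>\<bar> \<le> 1\<close>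
  almost everywhere. Moreover \<open>T\<^sup>* 1 = cnj c\<close>, so for \<open>\<bar>c\<bar> \<ge> 1\<close> the frame sum of the constant
  function 1 could only converge if it were 0 (\<open>frame_of_orbits_constant_coeff\<close>).

  Conversely let \<open>\<bar>\<phi>\<bar> \<le> 1\<close> almost everywhere and \<open>\<bar>c\<bar> < 1\<close>. If a family \<open>F\<close> satisfies
  \<open>\<Sum>k. \<bar>\<langle>y, F k\<rangle>\<bar>\<^sup>2 = \<parallel>y\<parallel>\<^sup>2 - \<parallel>T\<^sup>* y\<parallel>\<^sup>2\<close> for all \<open>y\<close>, then its frame sum along the orbits telescopes to
  \<open>\<parallel>y\<parallel>\<^sup>2 - lim \<parallel>T\<^sup>*\<^sup>n y\<parallel>\<^sup>2\<close>. Such a family is given explicitly by the projections to the Hardy space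
  of \<open>sqrt (1 - \<bar>\<phi>\<bar>\<^sup>2) * \<zeta>\<^sup>\<alpha>\<close> for all \<open>\<alpha>\<close>, and of \<open>\<phi> * \<zeta>\<^sup>\<alpha>\<close> for those \<open>\<alpha>\<close> that have a negative entry
  (\<open>defect_family_has_sum\<close>). The limit is 0 because the Fourier coefficients of \<open>\<phi>\<^sup>n\<close> tend to 0: they
  obey a triangular recursion whose diagonal entry is \<open>c\<close> (\<open>fourier_coeff_power_tendsto_0\<close>,
  \<open>adjoint_powers_tendsto_0\<close>).

  The Hilbert space structure used here, namely the Parseval identity and the projection onto the Hardy
  space, comes from uniqueness of Fourier coefficients (\<open>fourier_uniqueness\<close>) and completeness
  of \<open>L\<^sup>2\<close> in the form of the Riesz-Fischer theorem (\<open>Riesz_Fischer\<close>).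
\<close>

section \<open>Characters of the torus\<close>

lemma cis_measurable_circle [measurable]:
  "cis \<in> uniform_measure lborel {0..2*pi} \<rightarrow>\<^sub>M restrict_space borel (sphere 0 1)"
proof (rule measurable_restrict_space2)
  show "cis \<in> uniform_measure lborel {0..2*pi} \<rightarrow>\<^sub>M borel"
    by (simp cong: measurable_cong_sets) (intro borel_measurable_continuous_onI continuous_intros)
qed auto

lemma space_circle: "space circle = sphere 0 1"
  by (simp add: circle_def space_restrict_space)

lemma sets_circle: "sets circle = sets (restrict_space borel (sphere 0 1))"
  by (simp add: circle_def)

lemma prob_space_circle: "prob_space circle"
  unfolding circle_def
  by (intro prob_space.prob_space_distr prob_space_uniform_measure cis_measurable_circle) auto

interpretation circle: prob_space circle by (rule prob_space_circle)

lemma borel_measurable_circle: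
  "continuous_on (sphere 0 1) f \<Longrightarrow> f \<in> borel_measurable circle"
  unfolding measurable_cong_sets[OF sets_circle refl]
  by (rule borel_measurable_continuous_on_restrict)

lemma continuous_powi_sphere: "continuous_on (sphere 0 1) (\<lambda>z::complex. z powi k)"
  by (rule continuous_on_power_int, rule continuous_on_id, rule disjI2) auto

lemma integral_circle_powi: "(LINT z|circle. z powi k) = (if k = 0 then 1 else 0)"
proof (cases "k = 0")
  case True
  then show ?thesis by (simp add: circle.prob_space)
next
  case False
  have eq: "uniform_measure lborel {0..2*pi} = density lborel (\<lambda>t. ennreal (indicator {0..2*pi} t / (2*pi)))"
  proof -
    have "1 / ennreal (2 * pi) = ennreal (1 / (2 * pi))"
      using divide_ennreal[of 1 "2 * pi"] by simp
    thus ?thesis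
      unfolding uniform_measure_def
      by (intro density_cong) (auto split: split_indicator)
  qed
  have "(LINT z|circle. z powi k) = (LINT t|uniform_measure lborel {0..2*pi}. cis t powi k)"
    unfolding circle_def
  proof (rule integral_distr)
    show "(\<lambda>z::complex. z powi k) \<in> borel_measurable (restrict_space borel (sphere 0 1))"
      by (rule borel_measurable_continuous_on_restrict) (rule continuous_powi_sphere)
  qed measurable
  also have "\<dots> = (LINT t|lborel. (indicator {0..2*pi} t / (2*pi)) *\<^sub>R (cis t powi k))"
    unfolding eq
    by (rule integral_density)
       (auto intro!: borel_measurable_continuous_onI continuous_intros)
  also have "\<dots> = (LINT t:{0..2*pi}|lborel. cis (k * t) / (2*pi))"
    unfolding set_lebesgue_integral_def
    by (intro Bochner_Integration.integral_cong)
       (auto simp: cis_power_int scaleR_conv_of_real field_simps)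
  also have "\<dots> = cis (k * (2*pi)) / (\<i> * k * 2 * pi) - cis (k * (0::real)) / (\<i> * k * 2 * pi)"
  proof -
    have der: "((\<lambda>t. cis (k * t) / (\<i> * k * 2 * pi)) has_vector_derivative cis (k * t) / (2*pi))
            (at t within {0..2*pi})" for t :: real
      unfolding cis_conv_exp using False
      by (auto intro!: derivative_eq_intros has_vector_derivative_real_field simp: field_simps)
    show ?thesis
      unfolding set_lebesgue_integral_def
      by (rule integral_FTC_atLeastAtMost[OF _ der]) (auto intro!: continuous_intros)
  qed
  also have "cis (k * (2*pi)) = 1"
    using cos_int_2pin[of k] sin_int_2pin[of k] by (simp add: complex_eq_iff mult_ac)
  finally show ?thesis using False by simp
qed

lemma prob_space_torus: "prob_space (torus N)"
  unfolding torus_def by (intro prob_space_PiM prob_space_circle)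

interpretation torus: prob_space "torus N" for N by (rule prob_space_torus)

lemma space_torus: "space (torus N) = PiE {..<N} (\<lambda>_. sphere 0 1)"
  by (simp add: torus_def space_PiM space_circle)

lemma integral_torus_prod:
  fixes h :: "nat \<Rightarrow> complex \<Rightarrow> complex"
  assumes "\<And>j. j < N \<Longrightarrow> integrable circle (h j)"
  shows "(LINT \<zeta>|torus N. (\<Prod>j<N. h j (\<zeta> j))) = (\<Prod>j<N. LINT z|circle. h j z)"
proof -
  interpret product_sigma_finite "\<lambda>_::nat. circle" by unfold_locales
  show ?thesis unfolding torus_def
    using assms by (intro product_integral_prod) auto
qed

lemma torus_component_measurable:
  assumes "h \<in> borel_measurable circle" "j < N"
  shows "(\<lambda>\<zeta>. h (\<zeta> j)) \<in> borel_measurable (torus N)"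
  unfolding torus_def
  using assms by (intro measurable_compose[OF measurable_component_singleton[of j "{..<N}" "\<lambda>_. circle"] assms(1)]) auto

lemma monomial_measurable [measurable]: "monomial N \<alpha> \<in> borel_measurable (torus N)"
  unfolding monomial_def
  by (intro borel_measurable_prod torus_component_measurable borel_measurable_circle
      continuous_powi_sphere) auto

lemma norm_monomial: "\<zeta> \<in> space (torus N) \<Longrightarrow> cmod (monomial N \<alpha> \<zeta>) = 1"
  unfolding monomial_def
  by (simp add: prod_norm[symmetric] norm_power_int space_torus PiE_iff)

lemma monomial_cong: "(\<And>j. j < N \<Longrightarrow> \<alpha> j = \<beta> j) \<Longrightarrow> monomial N \<alpha> = monomial N \<beta>"
  by (auto simp: monomial_def fun_eq_iff)

lemma monomial_mult:
  "\<zeta> \<in> space (torus N) \<Longrightarrow> monomial N \<alpha> \<zeta> * monomial N \<beta> \<zeta> = monomial N (\<lambda>j. \<alpha> j + \<beta> j) \<zeta>"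
  unfolding monomial_def prod.distrib[symmetric]
  by (intro prod.cong) (auto simp: space_torus PiE_iff, metis lessThan_iff norm_zero power_int_add zero_neq_one)

lemma cnj_monomial:
  assumes "\<zeta> \<in> space (torus N)" shows "cnj (monomial N \<alpha> \<zeta>) = monomial N (\<lambda>j. - \<alpha> j) \<zeta>"
proof -
  have "cnj (\<zeta> j powi \<alpha> j) = \<zeta> j powi (- \<alpha> j)" if "j < N" for j
  proof -
    have "cmod (\<zeta> j) = 1" using assms that by (auto simp: space_torus PiE_iff)
    hence "cnj (\<zeta> j) = inverse (\<zeta> j)" by (simp add: inverse_complex_def complex_eq_iff cmod_def)
    thus ?thesis by (simp add: power_int_minus power_int_inverse)
  qed
  thus ?thesis unfolding monomial_def by simp
qed

lemma monomial_zero [simp]: "monomial N (\<lambda>_. 0) \<zeta> = 1"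
  by (simp add: monomial_def)

lemma integral_monomial:
  "(LINT \<zeta>|torus N. monomial N \<alpha> \<zeta>) = (if \<forall>j<N. \<alpha> j = 0 then 1 else 0)"
proof -
  have "integrable circle (\<lambda>z. z powi k)" for k
    by (rule circle.integrable_const_bound[where B=1])
       (auto intro!: AE_I2 borel_measurable_circle continuous_powi_sphere simp: space_circle norm_power_int)
  hence "(LINT \<zeta>|torus N. monomial N \<alpha> \<zeta>) = (\<Prod>j<N. LINT z|circle. z powi \<alpha> j)"
    unfolding monomial_def by (intro integral_torus_prod)
  thus ?thesis by (auto simp: integral_circle_powi)
qed

section \<open>Uniqueness of Fourier coefficients\<close>

text \<open>
  Trigonometric polynomials, generated without a normal form: closure under products and the
  expansion over a finite set of exponents both follow by induction.
\<close>
inductive trig_poly :: "(complex \<Rightarrow> complex) \<Rightarrow> bool" where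
  mono: "trig_poly (\<lambda>z. c * z powi k)"
| add: "trig_poly p \<Longrightarrow> trig_poly q \<Longrightarrow> trig_poly (\<lambda>z. p z + q z)"

lemma trig_poly_mult:
  assumes "trig_poly p" "trig_poly q"
  shows "\<exists>r. trig_poly r \<and> (\<forall>z\<in>sphere 0 1. r z = p z * q z)"
  using assms(1)
proof induction
  case (mono c k)
  show ?case using assms(2)
  proof induction
    case (mono d l)
    show ?case
    proof (intro exI[of _ "\<lambda>z. (c * d) * z powi (k + l)"] conjI trig_poly.mono ballI)
      fix z :: complex assume "z \<in> sphere 0 1"
      hence "z \<noteq> 0" by auto
      thus "c * d * z powi (k + l) = c * z powi k * (d * z powi l)"
        by (simp add: power_int_add)
    qed
  next
    case (add q1 q2)
    then obtain r1 r2 where "trig_poly r1" "\<forall>z\<in>sphere 0 1. r1 z = c * z powi k * q1 z"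
      "trig_poly r2" "\<forall>z\<in>sphere 0 1. r2 z = c * z powi k * q2 z" by auto
    thus ?case
      by (intro exI[of _ "\<lambda>z. r1 z + r2 z"]) (auto intro: trig_poly.add simp: algebra_simps)
  qed
next
  case (add p1 p2)
  then obtain r1 r2 where "trig_poly r1" "\<forall>z\<in>sphere 0 1. r1 z = p1 z * q z"
    "trig_poly r2" "\<forall>z\<in>sphere 0 1. r2 z = p2 z * q z" by auto
  thus ?case
    by (intro exI[of _ "\<lambda>z. r1 z + r2 z"]) (auto intro: trig_poly.add simp: algebra_simps)
qed

lemma trig_poly_expansion:
  assumes "trig_poly p"
  shows "\<exists>K c. finite K \<and> (\<forall>z. p z = (\<Sum>k\<in>K. c k * z powi k))"
  using assms
proof induction
  case (mono c k)
  show ?case by (intro exI[of _ "{k}"] exI[of _ "\<lambda>_. c"]) simp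
next
  case (add p q)
  then obtain K c L d where fin: "finite K" "finite L"
    and p: "\<And>z. p z = (\<Sum>k\<in>K. c k * z powi k)" and q: "\<And>z. q z = (\<Sum>k\<in>L. d k * z powi k)"
    by auto
  have "p z + q z = (\<Sum>k\<in>K \<union> L. ((if k \<in> K then c k else 0) + (if k \<in> L then d k else 0)) * z powi k)" for z
    unfolding p q distrib_right sum.distrib using fin
    by (intro arg_cong2[where f = "(+)"] sum.mono_neutral_cong_left) auto
  thus ?case using fin
    by (intro exI[of _ "K \<union> L"] exI[of _ "\<lambda>k. (if k \<in> K then c k else 0) + (if k \<in> L then d k else 0)"]) auto
qed

text \<open>
  On the circle \<open>cnj z = 1 / z\<close>, so the real and imaginary parts of \<open>z\<close> are combinations of
  \<open>z\<close> and \<open>1 / z\<close>. This lets the Stone-Weierstrass theorem for real polynomials on the plane do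
  the work of its trigonometric version.
\<close>
lemma real_polynomial_is_trig_poly_on_circle:
  assumes "real_polynomial_function (g :: complex \<Rightarrow> real)"
  shows "\<exists>p. trig_poly p \<and> (\<forall>z\<in>sphere 0 1. p z = of_real (g z))"
  using assms
proof induction
  case (linear f)
  define a b where "a = f 1" and "b = f \<i>"
  let ?p = "\<lambda>z. (a / 2 - \<i> * b / 2) * z powi 1 + (a / 2 + \<i> * b / 2) * z powi (-1)"
  have "?p z = of_real (f z)" if "z \<in> sphere 0 1" for z
  proof -
    have "cmod z = 1" using that by auto
    hence inv: "inverse z = cnj z"
      by (simp add: inverse_complex_def complex_eq_iff cmod_def)
    interpret bounded_linear f by fact
    have "z = Re z *\<^sub>R 1 + Im z *\<^sub>R \<i>" by (simp add: complex_eq_iff)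
    hence "f z = Re z * a + Im z * b" unfolding a_def b_def by (metis add scale real_scaleR_def)
    thus ?thesis by (simp add: inv complex_eq_iff algebra_simps)
  qed
  moreover have "trig_poly ?p" by (intro trig_poly.intros)
  ultimately show ?case by blast
next
  case (const c)
  show ?case using trig_poly.mono[of "of_real c" 0] by (intro exI[of _ "\<lambda>z. of_real c"]) auto
next
  case (add f g)
  then obtain p q where "trig_poly p" "\<forall>z\<in>sphere 0 1. p z = of_real (f z)"
    "trig_poly q" "\<forall>z\<in>sphere 0 1. q z = of_real (g z)" by auto
  thus ?case by (intro exI[of _ "\<lambda>z. p z + q z"]) (auto intro: trig_poly.add)
next
  case (mult f g)
  then obtain p q where "trig_poly p" "\<forall>z\<in>sphere 0 1. p z = of_real (f z)"
    "trig_poly q" "\<forall>z\<in>sphere 0 1. q z = of_real (g z)" by auto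
  thus ?case using trig_poly_mult[of p q] by fastforce
qed

text \<open>
  The tent functions \<open>max 0 (1 - n * dist(z, C))\<close> are continuous and decrease to the indicator of
  \<open>C\<close>; each is replaced by a trigonometric polynomial at distance at most \<open>1 / (n + 1)\<close>. The
  uniform bound is what dominated convergence needs later.
\<close>
lemma closed_indicator_limit_of_trig_polys:
  assumes "closed C"
  obtains p where "\<And>n::nat. trig_poly (p n)" "\<And>n z. z \<in> sphere 0 1 \<Longrightarrow> cmod (p n z) \<le> 2"
    "\<And>z. z \<in> sphere 0 1 \<Longrightarrow> (\<lambda>n. p n z) \<longlonglongrightarrow> indicator C z"
proof (cases "C = {}")
  case True
  have "trig_poly (\<lambda>z. 0)" using trig_poly.mono[of 0 0] by simp
  with True show ?thesis by (intro that[of "\<lambda>_ _. 0"]) auto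
next
  case False
  define h where "h n z = max 0 (1 - real n * infdist z C)" for n z
  have "\<exists>p. trig_poly p \<and> (\<forall>z\<in>sphere 0 1. cmod (p z - of_real (h n z)) < inverse (real (Suc n)))" for n
  proof -
    have "continuous_on (sphere 0 1) (h n)"
      unfolding h_def by (intro continuous_intros)
    then obtain g where "real_polynomial_function g"
      and g: "\<And>z. z \<in> sphere 0 1 \<Longrightarrow> \<bar>h n z - g z\<bar> < inverse (real (Suc n))"
      by (rule Stone_Weierstrass_real_polynomial_function[OF compact_sphere, of _ _ _ "inverse (real (Suc n))"]) auto
    then obtain p where "trig_poly p" "\<forall>z\<in>sphere 0 1. p z = of_real (g z)"
      using real_polynomial_is_trig_poly_on_circle by blast
    moreover have "cmod (of_real (g z) - of_real (h n z)) < inverse (real (Suc n))" if "z \<in> sphere 0 1" for z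
      using g[OF that] by (simp flip: of_real_diff add: abs_minus_commute del: of_nat_Suc)
    ultimately show ?thesis by auto
  qed
  then obtain p where p: "\<And>n. trig_poly (p n)"
    and ph: "\<And>n z. z \<in> sphere 0 1 \<Longrightarrow> cmod (p n z - of_real (h n z)) < inverse (real (Suc n))"
    by metis
  show ?thesis
  proof (rule that[of p])
    show "cmod (p n z) \<le> 2" if "z \<in> sphere 0 1" for n z
    proof -
      have "cmod (p n z) \<le> cmod (p n z - of_real (h n z)) + cmod (of_real (h n z))"
        by (metis norm_triangle_sub add.commute)
      also have "cmod (of_real (h n z)) \<le> 1"
        by (auto simp: h_def infdist_nonneg)
      also have "inverse (real (Suc n)) \<le> 1" by (simp add: field_simps)
      with ph[OF that, of n] have "cmod (p n z - of_real (h n z)) \<le> 1" by linarith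
      finally show ?thesis by simp
    qed
    show "(\<lambda>n. p n z) \<longlonglongrightarrow> indicator C z" if z: "z \<in> sphere 0 1" for z
    proof -
      have "(\<lambda>n. h n z) \<longlonglongrightarrow> indicator C z"
      proof (cases "z \<in> C")
        case True
        thus ?thesis by (simp add: h_def)
      next
        case nin: False
        hence pos: "infdist z C > 0" using assms False infdist_pos_not_in_closed by blast
        obtain n0 where n0: "real n0 * infdist z C > 1"
          using pos reals_Archimedean3 by blast
        have "h n z = 0" if "n \<ge> n0" for n
        proof -
          have "real n0 * infdist z C \<le> real n * infdist z C" using that pos by simp
          thus ?thesis using n0 by (simp add: h_def)
        qed
        thus ?thesis using nin by (intro tendsto_eventually) (auto simp: eventually_at_top_linorder)
      qed
      hence "(\<lambda>n. complex_of_real (h n z)) \<longlonglongrightarrow> of_real (indicator C z)" by (rule tendsto_of_real)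
      moreover have "(\<lambda>n. p n z - of_real (h n z)) \<longlonglongrightarrow> 0"
        by (rule Lim_null_comparison[OF _ LIMSEQ_inverse_real_of_nat])
           (use ph[OF z] in \<open>auto intro!: always_eventually less_imp_le\<close>)
      ultimately have "(\<lambda>n. (p n z - of_real (h n z)) + of_real (h n z)) \<longlonglongrightarrow> 0 + of_real (indicator C z)"
        by (intro tendsto_add)
      thus ?thesis by (cases "z \<in> C") simp_all
    qed
  qed (rule p)
qed

lemma trig_poly_measurable: "trig_poly p \<Longrightarrow> p \<in> borel_measurable circle"
  by (induction rule: trig_poly.induct)
     (auto intro!: borel_measurable_circle continuous_intros continuous_powi_sphere borel_measurable_add)

lemma integrable_mult_bounded:
  fixes f g :: "_ \<Rightarrow> complex"
  assumes "integrable M f" "g \<in> borel_measurable M" "\<And>x. x \<in> space M \<Longrightarrow> cmod (g x) \<le> B"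
  shows "integrable M (\<lambda>x. f x * g x)"
proof (rule Bochner_Integration.integrable_bound[of M "\<lambda>x. B * cmod (f x)"])
  show "AE x in M. norm (f x * g x) \<le> norm (B * cmod (f x))"
  proof (rule AE_I2)
    fix x assume "x \<in> space M"
    from assms(3)[OF this] have "cmod (f x) * cmod (g x) \<le> cmod (f x) * B" "0 \<le> B"
      using order_trans[OF norm_ge_zero] by (auto intro!: mult_left_mono)
    thus "norm (f x * g x) \<le> norm (B * cmod (f x))" by (simp add: norm_mult mult.commute)
  qed
qed (use assms in auto)

text \<open>
  A product of trigonometric polynomials in the separate coordinates expands into a finite
  combination of monomials.
\<close>
lemma integral_against_trig_product_eq_0:
  assumes f: "integrable (torus N) f" and zero: "\<And>\<alpha>. fourier_coeff N f \<alpha> = 0"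
    and p: "\<And>j. trig_poly (p j)"
  shows "(LINT \<zeta>|torus N. f \<zeta> * (\<Prod>j<N. p j (\<zeta> j))) = 0"
proof -
  obtain K c where fin: "\<And>j. finite (K j)" and pe: "\<And>j z. p j z = (\<Sum>k\<in>K j. c j k * z powi k)"
    using trig_poly_expansion[OF p] by metis
  have int: "integrable (torus N) (\<lambda>\<zeta>. f \<zeta> * monomial N \<alpha> \<zeta>)" for \<alpha>
    by (rule integrable_mult_bounded[OF f, where B=1]) (auto simp: norm_monomial)
  have z: "(LINT \<zeta>|torus N. f \<zeta> * monomial N \<alpha> \<zeta>) = 0" for \<alpha>
    using zero[of "\<lambda>j. - \<alpha> j"] by (simp add: fourier_coeff_def)
  have "(\<Prod>j<N. p j (\<zeta> j)) = (\<Sum>\<alpha>\<in>PiE {..<N} K. (\<Prod>j<N. c j (\<alpha> j)) * monomial N \<alpha> \<zeta>)" for \<zeta>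
    unfolding pe using fin
    by (subst prod_sum_PiE) (auto simp: monomial_def prod.distrib)
  hence "(LINT \<zeta>|torus N. f \<zeta> * (\<Prod>j<N. p j (\<zeta> j))) =
      (LINT \<zeta>|torus N. (\<Sum>\<alpha>\<in>PiE {..<N} K. (\<Prod>j<N. c j (\<alpha> j)) * (f \<zeta> * monomial N \<alpha> \<zeta>)))"
    by (simp add: sum_distrib_left mult_ac)
  also have "\<dots> = 0"
    using int by (subst Bochner_Integration.integral_sum) (auto simp: z)
  finally show ?thesis .
qed

text \<open>
  Each indicator factor is a bounded pointwise limit of trigonometric polynomials in its own
  coordinate, so the one-variable approximation suffices on the whole torus.
\<close>
lemma integral_over_closed_box_eq_0:
  assumes f: "integrable (torus N) f" and zero: "\<And>\<alpha>. fourier_coeff N f \<alpha> = 0"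
    and C: "\<And>j. closed (C j)"
  shows "(LINT \<zeta>|torus N. f \<zeta> * (\<Prod>j<N. indicator (C j) (\<zeta> j))) = 0"
proof -
  have "\<exists>p. (\<forall>n::nat. trig_poly (p n)) \<and> (\<forall>n. \<forall>z\<in>sphere 0 1. cmod (p n z) \<le> 2) \<and>
      (\<forall>z\<in>sphere 0 1. (\<lambda>n. p n z) \<longlonglongrightarrow> indicator (C j) z)" for j
    by (rule closed_indicator_limit_of_trig_polys[OF C[of j]]) blast
  then obtain p where "\<forall>j. (\<forall>n::nat. trig_poly (p j n)) \<and> (\<forall>n. \<forall>z\<in>sphere 0 1. cmod (p j n z) \<le> 2) \<and>
      (\<forall>z\<in>sphere 0 1. (\<lambda>n. p j n z) \<longlonglongrightarrow> indicator (C j) z)"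
    using choice[of "\<lambda>j p. (\<forall>n::nat. trig_poly (p n)) \<and> (\<forall>n. \<forall>z\<in>sphere 0 1. cmod (p n z) \<le> 2) \<and>
      (\<forall>z\<in>sphere 0 1. (\<lambda>n. p n z) \<longlonglongrightarrow> indicator (C j) z)"] by blast
  hence p: "\<And>j n::nat. trig_poly (p j n)"
    and b: "\<And>j n z. z \<in> sphere 0 1 \<Longrightarrow> cmod (p j n z) \<le> 2"
    and l: "\<And>j z. z \<in> sphere 0 1 \<Longrightarrow> (\<lambda>n. p j n z) \<longlonglongrightarrow> indicator (C j) z"
    by blast+
  have m: "(\<lambda>\<zeta>. \<Prod>j<N. p j n (\<zeta> j)) \<in> borel_measurable (torus N)" for n
    by (intro borel_measurable_prod torus_component_measurable trig_poly_measurable p) auto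
  have comp: "\<zeta> j \<in> sphere 0 1" if "\<zeta> \<in> space (torus N)" "j < N" for \<zeta> j
    using that by (auto simp: space_torus PiE_iff)
  have bd: "cmod (\<Prod>j<N. p j n (\<zeta> j)) \<le> 2 ^ N" if "\<zeta> \<in> space (torus N)" for \<zeta> n
    unfolding prod_norm[symmetric] using prod_mono[of "{..<N}" "\<lambda>j. cmod (p j n (\<zeta> j))" "\<lambda>_. 2"]
      b comp[OF that] by auto
  have "(\<lambda>n. LINT \<zeta>|torus N. f \<zeta> * (\<Prod>j<N. p j n (\<zeta> j))) \<longlonglongrightarrow>
        (LINT \<zeta>|torus N. f \<zeta> * (\<Prod>j<N. indicator (C j) (\<zeta> j)))"
  proof (rule integral_dominated_convergence[where w = "\<lambda>\<zeta>. 2 ^ N * cmod (f \<zeta>)"])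
    have [measurable]: "(\<lambda>\<zeta>. indicator (C j) (\<zeta> j) :: complex) \<in> borel_measurable (torus N)" if "j < N" for j
    proof (rule torus_component_measurable[OF _ that])
      show "indicator (C j) \<in> borel_measurable circle"
        unfolding measurable_cong_sets[OF sets_circle refl]
        by (intro measurable_restrict_space1 borel_measurable_indicator) (use C in auto)
    qed
    show "(\<lambda>\<zeta>. f \<zeta> * (\<Prod>j<N. indicator (C j) (\<zeta> j))) \<in> borel_measurable (torus N)"
      using f by (intro borel_measurable_times borel_measurable_prod) auto
    show "(\<lambda>\<zeta>. f \<zeta> * (\<Prod>j<N. p j n (\<zeta> j))) \<in> borel_measurable (torus N)" for n
      using f m by auto
    show "integrable (torus N) (\<lambda>\<zeta>. 2 ^ N * cmod (f \<zeta>))" using f by auto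
    show "AE \<zeta> in torus N. (\<lambda>n. f \<zeta> * (\<Prod>j<N. p j n (\<zeta> j))) \<longlonglongrightarrow> f \<zeta> * (\<Prod>j<N. indicator (C j) (\<zeta> j))"
      by (intro AE_I2 tendsto_intros l comp) auto
    show "AE \<zeta> in torus N. norm (f \<zeta> * (\<Prod>j<N. p j n (\<zeta> j))) \<le> 2 ^ N * cmod (f \<zeta>)" for n
      using bd by (intro AE_I2) (simp add: norm_mult mult.commute mult_left_mono)
  qed
  thus ?thesis
    by (simp add: integral_against_trig_product_eq_0[OF f zero p] LIMSEQ_const_iff)
qed

lemma sets_circle_generated: "sets circle = sigma_sets (sphere 0 1) {C. closed C \<and> C \<subseteq> sphere 0 1}"
proof -
  have "sets circle = (\<inter>) (sphere 0 1) ` sigma_sets UNIV (Collect closed)"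
    by (simp add: sets_circle sets_restrict_space borel_eq_closed)
  also have "\<dots> = sigma_sets (sphere 0 1) ((\<inter>) (sphere 0 1) ` Collect closed)"
    by (intro sigma_sets_Int) (auto intro!: sigma_sets.Basic)

  also have "(\<inter>) (sphere 0 1) ` Collect closed = {C :: complex set. closed C \<and> C \<subseteq> sphere 0 1}"
  proof (intro equalityI subsetI)
    fix C :: "complex set" assume "C \<in> {C. closed C \<and> C \<subseteq> sphere 0 1}"
    hence "C = sphere 0 1 \<inter> C" "closed C" by auto
    thus "C \<in> (\<inter>) (sphere 0 1) ` Collect closed" by blast
  qed (auto intro: closed_Int)
  finally show ?thesis .
qed

text \<open>
  Closed boxes are stable under intersection, which makes this generator suitable for a
  Dynkin argument.
\<close>
lemma sets_torus_generated:
  "sets (torus N) = sigma_sets (space (torus N))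
     {PiE {..<N} C | C. \<forall>j<N. closed (C j) \<and> C j \<subseteq> sphere 0 1}"
proof -
  let ?E = "{C. closed C \<and> C \<subseteq> sphere (0::complex) 1}"
  let ?P = "{{f\<in>(\<Pi>\<^sub>E i\<in>{..<N}. sphere (0::complex) 1). \<forall>i\<in>j. f i \<in> A i} | A j. j \<in> {{..<N}} \<and> A \<in> Pi j (\<lambda>_. ?E)}"
  let ?Q = "{PiE {..<N} C | C. \<forall>j<N. closed (C j) \<and> C j \<subseteq> sphere (0::complex) 1}"
  have circle: "sets circle = sets (sigma (sphere 0 1) ?E)"
    unfolding sets_circle_generated by (rule sets_measure_of[symmetric]) blast
  have 1: "sets (torus N) = sets (\<Pi>\<^sub>M i\<in>{..<N}. sigma (sphere 0 1) ?E)"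
    unfolding torus_def by (intro sets_PiM_cong refl circle)
  have 2: "sets (\<Pi>\<^sub>M i\<in>{..<N}. sigma (sphere 0 1) ?E) = sets (sigma (\<Pi>\<^sub>E i\<in>{..<N}. sphere 0 1) ?P)"
  proof (rule sets_PiM_sigma)
    show "\<exists>S\<subseteq>?E. countable S \<and> sphere 0 1 = \<Union>S"
      by (intro exI[of _ "{sphere 0 1}"]) simp
  qed auto
  have P: "sets (torus N) = sets (sigma (\<Pi>\<^sub>E i\<in>{..<N}. sphere 0 1) ?P)"
    by (rule trans[OF 1 2])
  have box: "{f \<in> (\<Pi>\<^sub>E i\<in>{..<N}. sphere 0 1). \<forall>i\<in>{..<N}. f i \<in> A i} = PiE {..<N} A"
    if "\<And>i. i < N \<Longrightarrow> A i \<subseteq> sphere 0 1" for A :: "nat \<Rightarrow> complex set"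
  proof -
    have "f i \<in> sphere 0 1" if "f i \<in> A i" "i < N" for f i
      using \<open>\<And>i. i < N \<Longrightarrow> A i \<subseteq> sphere 0 1\<close>[OF that(2)] that(1) by (rule subsetD)
    thus ?thesis by (simp only: PiE_iff set_eq_iff mem_Collect_eq Ball_def lessThan_iff) blast
  qed
  have PQ: "?P = ?Q"
  proof (intro equalityI subsetI)
    fix X assume "X \<in> ?P"
    then obtain A j where A: "X = {f\<in>(\<Pi>\<^sub>E i\<in>{..<N}. sphere 0 1). \<forall>i\<in>j. f i \<in> A i}"
      "j \<in> {{..<N}}" "A \<in> Pi j (\<lambda>_. ?E)"
      unfolding mem_Collect_eq by (elim exE conjE)
    hence "X = PiE {..<N} A \<and> (\<forall>j<N. closed (A j) \<and> A j \<subseteq> sphere 0 1)"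
      using box[of A] by (simp add: Pi_iff)
    thus "X \<in> ?Q" unfolding mem_Collect_eq by (intro exI[where x = A])
  next
    fix X assume "X \<in> ?Q"
    then obtain A where A: "X = PiE {..<N} A" "\<forall>j<N. closed (A j) \<and> A j \<subseteq> sphere 0 1"
      unfolding mem_Collect_eq by (elim exE conjE)
    hence "X = {f\<in>(\<Pi>\<^sub>E i\<in>{..<N}. sphere 0 1). \<forall>i\<in>{..<N}. f i \<in> A i} \<and> {..<N} \<in> {{..<N}} \<and> A \<in> Pi {..<N} (\<lambda>_. ?E)"
      using box[of A] by (simp add: Pi_iff)
    thus "X \<in> ?P" unfolding mem_Collect_eq by (intro exI[where x = A] exI[where x = "{..<N}"])
  qed
  have Q: "sets (sigma (\<Pi>\<^sub>E i\<in>{..<N}. sphere 0 1) ?Q) = sigma_sets (space (torus N)) ?Q"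
    unfolding space_torus
    by (intro sets_measure_of) (auto simp: PiE_iff subset_iff)
  show ?thesis using P Q unfolding PQ by (rule trans)
qed

lemma AE_eq_0_if_set_integrals_eq_0:
  fixes f :: "'a \<Rightarrow> complex"
  assumes f: "integrable M f" and z: "\<And>A. A \<in> sets M \<Longrightarrow> (LINT x:A|M. f x) = 0"
  shows "AE x in M. f x = 0"
proof -
  have real: "AE x in M. g x \<le> 0" if g: "integrable M g"
    and gz: "\<And>A. A \<in> sets M \<Longrightarrow> (LINT x:A|M. g x) = 0" for g :: "'a \<Rightarrow> real"
  proof -
    have [measurable]: "g \<in> borel_measurable M" using g by auto
    let ?A = "{x \<in> space M. g x > 0}"
    have "AE x in M. indicator ?A x * g x = 0"
    proof (subst integral_nonneg_eq_0_iff_AE[symmetric])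
      show "integrable M (\<lambda>x. indicator ?A x * g x)"
        using integrable_mult_indicator[OF _ g, of ?A] by simp
      show "AE x in M. 0 \<le> indicator ?A x * g x" by (auto split: split_indicator)
      show "(LINT x|M. indicator ?A x * g x) = 0"
        using gz[of ?A] by (simp add: set_lebesgue_integral_def)
    qed
    with AE_space show ?thesis by eventually_elim (auto split: split_indicator_asm simp: not_less)
  qed
  have si: "set_integrable M A f" if "A \<in> sets M" for A
    unfolding set_integrable_def using that f by (rule integrable_mult_indicator)
  have Re: "(LINT x:A|M. Re (f x)) = 0" if "A \<in> sets M" for A
    using z[OF that] integral_Re[OF si[OF that, unfolded set_integrable_def]]
    by (simp add: set_lebesgue_integral_def)
  have Im: "(LINT x:A|M. Im (f x)) = 0" if "A \<in> sets M" for A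
    using z[OF that] integral_Im[OF si[OF that, unfolded set_integrable_def]]
    by (simp add: set_lebesgue_integral_def)
  have "AE x in M. Re (f x) \<le> 0" "AE x in M. Im (f x) \<le> 0"
    by (intro real f integrable_Re integrable_Im Re Im; simp)+
  moreover have "AE x in M. - Re (f x) \<le> 0" "AE x in M. - Im (f x) \<le> 0"
    using Re Im by (intro real f integrable_Re integrable_Im integrable_minus; simp add: set_lebesgue_integral_def)+
  ultimately show ?thesis by eventually_elim (auto simp: complex_eq_iff)
qed

text \<open>
  The sets over which \<open>f\<close> integrates to 0 form a Dynkin system. It contains the closed boxes,
  hence all measurable sets.
\<close>
theorem fourier_uniqueness:
  assumes f: "integrable (torus N) f" and zero: "\<And>\<alpha>. fourier_coeff N f \<alpha> = 0"
  shows "AE \<zeta> in torus N. f \<zeta> = 0"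
proof (rule AE_eq_0_if_set_integrals_eq_0[OF f])
  let ?G = "{PiE {..<N} C | C. \<forall>j<N. closed (C j) \<and> C j \<subseteq> sphere (0::complex) 1}"
  have si: "set_integrable (torus N) A f" if "A \<in> sets (torus N)" for A
    unfolding set_integrable_def using that f by (rule integrable_mult_indicator)
  have tot: "(LINT \<zeta>|torus N. f \<zeta>) = 0"
    using zero[of "\<lambda>_. 0"] by (simp add: fourier_coeff_def)
  fix A assume "A \<in> sets (torus N)"
  hence A: "A \<in> sigma_sets (space (torus N)) ?G" by (simp add: sets_torus_generated)
  have st: "\<And>B. B \<in> sigma_sets (space (torus N)) ?G \<Longrightarrow> B \<in> sets (torus N)"
    by (simp add: sets_torus_generated)
  have "Int_stable ?G"
  proof (rule Int_stableI)
    fix a b assume "a \<in> ?G" "b \<in> ?G"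
    then obtain C D where "a = PiE {..<N} C" "\<forall>j<N. closed (C j) \<and> C j \<subseteq> sphere 0 1"
      "b = PiE {..<N} D" "\<forall>j<N. closed (D j) \<and> D j \<subseteq> sphere 0 1"
      unfolding mem_Collect_eq by (elim exE conjE)
    hence "a \<inter> b = PiE {..<N} (\<lambda>j. C j \<inter> D j) \<and> (\<forall>j<N. closed (C j \<inter> D j) \<and> C j \<inter> D j \<subseteq> sphere 0 1)"
      by (simp add: PiE_Int closed_Int le_infI1)
    thus "a \<inter> b \<in> ?G"
      unfolding mem_Collect_eq by (intro exI[where x = "\<lambda>j. C j \<inter> D j"])
  qed
  moreover have "?G \<subseteq> Pow (space (torus N))"
    by (auto simp: space_torus PiE_iff)
  ultimately show "(LINT \<zeta>:A|torus N. f \<zeta>) = 0" using A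
  proof (induction rule: sigma_sets_induct_disjoint)
    case (basic A)
    then obtain C where C: "A = PiE {..<N} C" "\<forall>j<N. closed (C j) \<and> C j \<subseteq> sphere 0 1"
      unfolding mem_Collect_eq by (elim exE conjE)
    \<comment> \<open>the box lemma asks for a closed set at every index, also from \<open>N\<close> on\<close>
    define D where "D j = (if j < N then C j else {})" for j
    have "(LINT \<zeta>:A|torus N. f \<zeta>) = (LINT \<zeta>|torus N. f \<zeta> * (\<Prod>j<N. indicator (D j) (\<zeta> j)))"
      unfolding set_lebesgue_integral_def
    proof (intro Bochner_Integration.integral_cong refl)
      fix \<zeta> assume "\<zeta> \<in> space (torus N)"
      hence "\<zeta> \<in> A \<longleftrightarrow> (\<forall>j<N. \<zeta> j \<in> C j)" by (auto simp: C space_torus PiE_iff)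
      hence "(\<Prod>j<N. indicator (D j) (\<zeta> j)) = (indicator A \<zeta> :: complex)"
        by (auto simp: D_def indicator_def)
      thus "indicator A \<zeta> *\<^sub>R f \<zeta> = f \<zeta> * (\<Prod>j<N. indicator (D j) (\<zeta> j))"
        by (simp add: indicator_def)
    qed
    also have "\<dots> = 0" by (rule integral_over_closed_box_eq_0[OF f zero]) (auto simp: D_def C)
    finally show ?case .
  next
    case empty
    show ?case by (simp add: set_lebesgue_integral_def)
  next
    case (compl A)
    have "(LINT \<zeta>:space (torus N) - A|torus N. f \<zeta>) = (LINT \<zeta>|torus N. f \<zeta> - indicator A \<zeta> *\<^sub>R f \<zeta>)"
      unfolding set_lebesgue_integral_def
      by (intro Bochner_Integration.integral_cong) (auto split: split_indicator)
    also have "\<dots> = 0"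
      using compl(2) si[OF st[OF compl(1)]] f tot
      by (simp add: set_lebesgue_integral_def set_integrable_def)
    finally show ?case .
  next
    case (union A)
    have Ai: "A i \<in> sets (torus N)" for i using union(2) by (intro st) (rule subsetD[OF _ rangeI])
    have "(LINT \<zeta>:(\<Union>i. A i)|torus N. f \<zeta>) = (\<Sum>i. LINT \<zeta>:A i|torus N. f \<zeta>)"
      using Ai union(1)
      by (intro lebesgue_integral_countable_add si sets.countable_UN'') (simp_all add: disjoint_family_on_def)
    thus ?case using union by simp
  qed
qed

section \<open>Square-integrable functions\<close>

lemma borel_measurable_cnj [measurable (raw)]:
  "f \<in> borel_measurable M \<Longrightarrow> (\<lambda>x. cnj (f x)) \<in> borel_measurable M"
  by (rule measurable_compose[OF _ borel_measurable_continuous_onI[OF continuous_on_cnj[OF continuous_on_id]]])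

lemma mult_cnj_self: "z * cnj z = (complex_of_real (cmod z))\<^sup>2"
  by (simp add: complex_norm_square flip: of_real_power)

text \<open>
  The real number \<open>Re (L2_inner N f f)\<close>; squared norms rather than norms are what the
  frame inequalities and the Parseval identity speak about.
\<close>
definition L2_normsq :: "nat \<Rightarrow> ((nat \<Rightarrow> complex) \<Rightarrow> complex) \<Rightarrow> real" where
  "L2_normsq N f = (LINT \<zeta>|torus N. (cmod (f \<zeta>))\<^sup>2)"

lemma L2_measurable [measurable_dest]: "f \<in> L2 N \<Longrightarrow> f \<in> borel_measurable (torus N)"
  by (simp add: L2_def)

lemma L2_inner_self: "L2_inner N f f = of_real (L2_normsq N f)"
  by (simp add: L2_inner_def L2_normsq_def complex_norm_square[symmetric] del: of_real_power)

lemma L2_normsq_nonneg: "L2_normsq N f \<ge> 0"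
  by (simp add: L2_normsq_def)

lemma integrable_mult_L2:
  assumes "f \<in> L2 N" "g \<in> L2 N"
  shows "integrable (torus N) (\<lambda>\<zeta>. f \<zeta> * g \<zeta>)"
proof (rule Bochner_Integration.integrable_bound)
  show "integrable (torus N) (\<lambda>\<zeta>. (cmod (f \<zeta>))\<^sup>2 + (cmod (g \<zeta>))\<^sup>2)"
    using assms by (auto simp: L2_def)
  show "AE \<zeta> in torus N. norm (f \<zeta> * g \<zeta>) \<le> norm ((cmod (f \<zeta>))\<^sup>2 + (cmod (g \<zeta>))\<^sup>2)"
  proof (rule AE_I2)
    fix \<zeta>
    have "2 * (cmod (f \<zeta>) * cmod (g \<zeta>)) \<le> (cmod (f \<zeta>))\<^sup>2 + (cmod (g \<zeta>))\<^sup>2"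
      using sum_squares_bound[of "cmod (f \<zeta>)" "cmod (g \<zeta>)"] by (simp only: mult.assoc)
    moreover have "0 \<le> cmod (f \<zeta>) * cmod (g \<zeta>)" by simp
    ultimately show "norm (f \<zeta> * g \<zeta>) \<le> norm ((cmod (f \<zeta>))\<^sup>2 + (cmod (g \<zeta>))\<^sup>2)"
      unfolding norm_mult real_norm_def by linarith
  qed
qed (use assms in measurable)

lemma L2_cnj: "f \<in> L2 N \<Longrightarrow> (\<lambda>\<zeta>. cnj (f \<zeta>)) \<in> L2 N"
  by (auto simp: L2_def)

lemma integrable_inner_L2:
  "f \<in> L2 N \<Longrightarrow> g \<in> L2 N \<Longrightarrow> integrable (torus N) (\<lambda>\<zeta>. f \<zeta> * cnj (g \<zeta>))"
  by (intro integrable_mult_L2 L2_cnj)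

lemma L2_mult_AE_bounded:
  assumes "f \<in> L2 N" "g \<in> borel_measurable (torus N)" "AE \<zeta> in torus N. cmod (g \<zeta>) \<le> B"
  shows "(\<lambda>\<zeta>. g \<zeta> * f \<zeta>) \<in> L2 N"
proof -
  have "integrable (torus N) (\<lambda>\<zeta>. (cmod (g \<zeta> * f \<zeta>))\<^sup>2)"
  proof (rule Bochner_Integration.integrable_bound)
    show "integrable (torus N) (\<lambda>\<zeta>. B\<^sup>2 * (cmod (f \<zeta>))\<^sup>2)"
      using assms by (auto simp: L2_def)
    show "AE \<zeta> in torus N. norm ((cmod (g \<zeta> * f \<zeta>))\<^sup>2) \<le> norm (B\<^sup>2 * (cmod (f \<zeta>))\<^sup>2)"
      using assms(3) by eventually_elim (simp add: norm_mult power_mult_distrib mult_right_mono power_mono)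
  qed (use assms in measurable)
  with assms show ?thesis by (auto simp: L2_def)
qed

lemma L2_add:
  assumes "f \<in> L2 N" "g \<in> L2 N"
  shows "(\<lambda>\<zeta>. f \<zeta> + g \<zeta>) \<in> L2 N"
proof -
  have "integrable (torus N) (\<lambda>\<zeta>. (cmod (f \<zeta> + g \<zeta>))\<^sup>2)"
  proof (rule Bochner_Integration.integrable_bound)
    show "integrable (torus N) (\<lambda>\<zeta>. 2 * (cmod (f \<zeta>))\<^sup>2 + 2 * (cmod (g \<zeta>))\<^sup>2)"
      using assms by (auto simp: L2_def)
    show "AE \<zeta> in torus N. norm ((cmod (f \<zeta> + g \<zeta>))\<^sup>2) \<le> norm (2 * (cmod (f \<zeta>))\<^sup>2 + 2 * (cmod (g \<zeta>))\<^sup>2)"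
    proof (rule AE_I2)
      fix \<zeta>
      have "(cmod (f \<zeta> + g \<zeta>))\<^sup>2 \<le> (cmod (f \<zeta>) + cmod (g \<zeta>))\<^sup>2"
        by (intro power_mono norm_triangle_ineq) simp
      also have "\<dots> \<le> 2 * (cmod (f \<zeta>))\<^sup>2 + 2 * (cmod (g \<zeta>))\<^sup>2"
        using sum_squares_bound[of "cmod (f \<zeta>)" "cmod (g \<zeta>)"] by (simp add: power2_sum)
      finally show "norm ((cmod (f \<zeta> + g \<zeta>))\<^sup>2) \<le> norm (2 * (cmod (f \<zeta>))\<^sup>2 + 2 * (cmod (g \<zeta>))\<^sup>2)"
        by simp
    qed
  qed (use assms in measurable)
  with assms show ?thesis by (auto simp: L2_def)
qed

lemma L2_cmult: "f \<in> L2 N \<Longrightarrow> (\<lambda>\<zeta>. c * f \<zeta>) \<in> L2 N"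
  by (rule L2_mult_AE_bounded[where B = "cmod c"]) auto

lemma L2_diff: "f \<in> L2 N \<Longrightarrow> g \<in> L2 N \<Longrightarrow> (\<lambda>\<zeta>. f \<zeta> - g \<zeta>) \<in> L2 N"
  using L2_add[of f N "\<lambda>\<zeta>. (-1) * g \<zeta>"] L2_cmult[of g N "-1"] by simp

lemma L2_of_bounded:
  "f \<in> borel_measurable (torus N) \<Longrightarrow> AE \<zeta> in torus N. cmod (f \<zeta>) \<le> B \<Longrightarrow> f \<in> L2 N"
  using L2_mult_AE_bounded[of "\<lambda>_. 1" N f B] by (simp add: L2_def)

lemma L2_monomial: "monomial N \<alpha> \<in> L2 N"
  by (rule L2_of_bounded[where B = 1]) (auto simp: norm_monomial)

lemma L2_sum: "(\<And>i. i \<in> F \<Longrightarrow> f i \<in> L2 N) \<Longrightarrow> (\<lambda>\<zeta>. \<Sum>i\<in>F. f i \<zeta>) \<in> L2 N"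
proof (induction F rule: infinite_finite_induct)
  case (insert i F)
  thus ?case by (simp add: L2_add)
qed (auto simp: L2_def)

lemma L2_integrable: "f \<in> L2 N \<Longrightarrow> integrable (torus N) f"
  using integrable_mult_L2[of f N "\<lambda>_. 1"] by (simp add: L2_def)

lemma L2_inner_add_left:
  "f \<in> L2 N \<Longrightarrow> g \<in> L2 N \<Longrightarrow> h \<in> L2 N \<Longrightarrow>
    L2_inner N (\<lambda>\<zeta>. f \<zeta> + g \<zeta>) h = L2_inner N f h + L2_inner N g h"
  by (simp add: L2_inner_def distrib_right integrable_inner_L2)

lemma L2_inner_diff_left:
  "f \<in> L2 N \<Longrightarrow> g \<in> L2 N \<Longrightarrow> h \<in> L2 N \<Longrightarrow>
    L2_inner N (\<lambda>\<zeta>. f \<zeta> - g \<zeta>) h = L2_inner N f h - L2_inner N g h"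
  by (simp add: L2_inner_def left_diff_distrib integrable_inner_L2)

lemma L2_inner_cmult_left: "L2_inner N (\<lambda>\<zeta>. c * f \<zeta>) h = c * L2_inner N f h"
  by (simp add: L2_inner_def mult.assoc)

lemma L2_inner_sum_left:
  "(\<And>i. i \<in> F \<Longrightarrow> f i \<in> L2 N) \<Longrightarrow> h \<in> L2 N \<Longrightarrow>
    L2_inner N (\<lambda>\<zeta>. \<Sum>i\<in>F. f i \<zeta>) h = (\<Sum>i\<in>F. L2_inner N (f i) h)"
  unfolding L2_inner_def sum_distrib_right
  by (rule Bochner_Integration.integral_sum) (rule integrable_inner_L2)

lemma L2_inner_commute: "L2_inner N g f = cnj (L2_inner N f g)"
  unfolding L2_inner_def using Bochner_Integration.integral_cnj[of "torus N" "\<lambda>\<zeta>. f \<zeta> * cnj (g \<zeta>)"] by (simp add: mult.commute)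

lemma L2_normsq_cong_AE:
  assumes "f \<in> L2 N" "f' \<in> L2 N" "AE \<zeta> in torus N. f \<zeta> = f' \<zeta>"
  shows "L2_normsq N f = L2_normsq N f'"
  unfolding L2_normsq_def
  using assms(3) by (intro integral_cong_AE) (use assms in \<open>auto dest: L2_measurable\<close>)

text \<open>
  Pythagoras: when \<open>c * g\<close> is the orthogonal projection of \<open>f\<close> to the line of \<open>g\<close>, the squared
  norms subtract. With \<open>g\<close> arbitrary this gives the Cauchy-Schwarz inequality; with \<open>c = 1\<close> and \<open>g\<close> a partial
  Fourier sum it gives Bessel's inequality.
\<close>
lemma L2_normsq_diff_projection:
  assumes f: "f \<in> L2 N" and g: "g \<in> L2 N" and fg: "L2_inner N f g = c * of_real (L2_normsq N g)"
  shows "L2_normsq N (\<lambda>\<zeta>. f \<zeta> - c * g \<zeta>) = L2_normsq N f - (cmod c)\<^sup>2 * L2_normsq N g"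
proof -
  let ?h = "\<lambda>\<zeta>. f \<zeta> - c * g \<zeta>"
  have h: "?h \<in> L2 N" "(\<lambda>\<zeta>. c * g \<zeta>) \<in> L2 N" using f g by (auto intro: L2_diff L2_cmult)
  have gh: "L2_inner N ?h g = 0"
    using f g h by (simp add: L2_inner_diff_left L2_inner_cmult_left fg L2_inner_self)
  have "L2_inner N ?h ?h = L2_inner N f ?h - c * L2_inner N g ?h"
    using f g h by (subst L2_inner_diff_left) (auto simp: L2_inner_cmult_left)
  also have "L2_inner N g ?h = 0" using gh by (subst L2_inner_commute) simp
  also have "L2_inner N f ?h = cnj (L2_inner N ?h f)" by (rule L2_inner_commute)
  also have "L2_inner N ?h f = L2_normsq N f - c * cnj (L2_inner N f g)"
    using f g h by (subst L2_inner_diff_left) (auto simp: L2_inner_cmult_left L2_inner_self L2_inner_commute[of N f g])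
  finally have "complex_of_real (L2_normsq N ?h) = L2_normsq N f - cnj c * c * L2_normsq N g"
    by (simp add: L2_inner_self fg)
  also have "cnj c * c = (cmod c)\<^sup>2" by (simp add: mult_cnj_self mult.commute)
  finally have "complex_of_real (L2_normsq N ?h) = of_real (L2_normsq N f - (cmod c)\<^sup>2 * L2_normsq N g)"
    by simp
  thus ?thesis unfolding of_real_eq_iff .
qed

lemma L2_Cauchy_Schwarz:
  assumes "f \<in> L2 N" "g \<in> L2 N"
  shows "(cmod (L2_inner N f g))\<^sup>2 \<le> L2_normsq N f * L2_normsq N g"
proof (cases "L2_normsq N g = 0")
  case True
  have "AE \<zeta> in torus N. (cmod (g \<zeta>))\<^sup>2 = 0"
    using True assms by (subst integral_nonneg_eq_0_iff_AE[symmetric]) (auto simp: L2_normsq_def L2_def)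
  hence "L2_inner N f g = (LINT \<zeta>|torus N. 0)"
    unfolding L2_inner_def using assms
    by (intro integral_cong_AE) (auto dest: L2_measurable)
  thus ?thesis using True by simp
next
  case False
  hence pos: "L2_normsq N g > 0" using L2_normsq_nonneg[of N g] by linarith
  define c where "c = L2_inner N f g / L2_normsq N g"
  have c: "L2_inner N f g = c * L2_normsq N g" using pos by (simp add: c_def)
  have "(cmod c)\<^sup>2 * L2_normsq N g \<le> L2_normsq N f"
    using L2_normsq_diff_projection[OF assms c] L2_normsq_nonneg[of N "\<lambda>\<zeta>. f \<zeta> - c * g \<zeta>"] by linarith
  hence "(cmod c)\<^sup>2 * L2_normsq N g * L2_normsq N g \<le> L2_normsq N f * L2_normsq N g"
    using pos by (intro mult_right_mono) auto
  thus ?thesis using pos by (simp add: c norm_mult power_mult_distrib power2_eq_square mult_ac)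
qed

section \<open>Fourier coefficients\<close>

lemma fourier_coeff_eq_inner: "fourier_coeff N f \<alpha> = L2_inner N f (monomial N \<alpha>)"
  unfolding fourier_coeff_def L2_inner_def
  by (intro Bochner_Integration.integral_cong) (auto simp: cnj_monomial)

lemma fourier_coeff_cong: "(\<And>j. j < N \<Longrightarrow> \<alpha> j = \<beta> j) \<Longrightarrow> fourier_coeff N f \<alpha> = fourier_coeff N f \<beta>"
  unfolding fourier_coeff_eq_inner using monomial_cong[of N \<alpha> \<beta>] by simp

text \<open>
  Sums over characters need every character to occur exactly once. The extensional functions on
  \<open>{..<N}\<close> pick one representative of each class of multi-indices that agree below \<open>N\<close>.
\<close>
definition multi_indices :: "nat \<Rightarrow> (nat \<Rightarrow> int) set" where
  "multi_indices N = PiE {..<N} (\<lambda>_. UNIV)"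

definition nonneg_multi_indices :: "nat \<Rightarrow> (nat \<Rightarrow> int) set" where
  "nonneg_multi_indices N = PiE {..<N} (\<lambda>_. {0..})"

lemma nonneg_multi_indices_subset: "nonneg_multi_indices N \<subseteq> multi_indices N"
  unfolding nonneg_multi_indices_def multi_indices_def by (intro PiE_mono) auto

lemma countable_multi_indices: "countable (multi_indices N)"
  unfolding multi_indices_def by (intro countable_PiE) auto

lemma fourier_coeff_restrict: "fourier_coeff N f (restrict \<alpha> {..<N}) = fourier_coeff N f \<alpha>"
  by (intro fourier_coeff_cong) auto

lemma restrict_in_multi_indices: "restrict \<alpha> {..<N} \<in> multi_indices N"
  by (auto simp: multi_indices_def)

lemma restrict_in_nonneg_multi_indices:
  "restrict \<alpha> {..<N} \<in> nonneg_multi_indices N \<longleftrightarrow> (\<forall>j<N. 0 \<le> \<alpha> j)"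
  by (auto simp: nonneg_multi_indices_def PiE_iff)

lemma fourier_coeff_monomial:
  assumes "\<alpha> \<in> multi_indices N" "\<beta> \<in> multi_indices N"
  shows "fourier_coeff N (monomial N \<alpha>) \<beta> = (if \<alpha> = \<beta> then 1 else 0)"
proof -
  have "fourier_coeff N (monomial N \<alpha>) \<beta> = (LINT \<zeta>|torus N. monomial N (\<lambda>j. \<alpha> j + - \<beta> j) \<zeta>)"
    unfolding fourier_coeff_def
    by (intro Bochner_Integration.integral_cong refl monomial_mult)
  also have "\<dots> = (if \<forall>j<N. \<alpha> j = \<beta> j then 1 else 0)"
    by (simp add: integral_monomial)
  also have "(\<forall>j<N. \<alpha> j = \<beta> j) \<longleftrightarrow> \<alpha> = \<beta>"
    using assms by (auto simp: multi_indices_def intro: PiE_ext)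
  finally show ?thesis .
qed

lemma fourier_coeff_sum:
  assumes "finite F" "F \<subseteq> multi_indices N" "\<beta> \<in> multi_indices N"
  shows "fourier_coeff N (\<lambda>\<zeta>. \<Sum>\<alpha>\<in>F. c \<alpha> * monomial N \<alpha> \<zeta>) \<beta> = (if \<beta> \<in> F then c \<beta> else 0)"
proof -
  have "fourier_coeff N (\<lambda>\<zeta>. \<Sum>\<alpha>\<in>F. c \<alpha> * monomial N \<alpha> \<zeta>) \<beta>
      = (\<Sum>\<alpha>\<in>F. c \<alpha> * fourier_coeff N (monomial N \<alpha>) \<beta>)"
    unfolding fourier_coeff_eq_inner
    by (simp add: L2_inner_sum_left L2_cmult L2_monomial L2_inner_cmult_left)
  also have "\<dots> = (\<Sum>\<alpha>\<in>F. if \<alpha> = \<beta> then c \<alpha> else 0)"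
    using assms by (intro sum.cong) (auto simp: fourier_coeff_monomial)
  finally show ?thesis using assms by simp
qed

lemma fourier_coeff_diff:
  "f \<in> L2 N \<Longrightarrow> g \<in> L2 N \<Longrightarrow>
    fourier_coeff N (\<lambda>\<zeta>. f \<zeta> - g \<zeta>) \<alpha> = fourier_coeff N f \<alpha> - fourier_coeff N g \<alpha>"
  unfolding fourier_coeff_eq_inner by (intro L2_inner_diff_left L2_monomial)

lemma fourier_coeff_add:
  "f \<in> L2 N \<Longrightarrow> g \<in> L2 N \<Longrightarrow>
    fourier_coeff N (\<lambda>\<zeta>. f \<zeta> + g \<zeta>) \<alpha> = fourier_coeff N f \<alpha> + fourier_coeff N g \<alpha>"
  unfolding fourier_coeff_eq_inner by (intro L2_inner_add_left L2_monomial)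

lemma fourier_coeff_cmult: "fourier_coeff N (\<lambda>\<zeta>. c * f \<zeta>) \<alpha> = c * fourier_coeff N f \<alpha>"
  unfolding fourier_coeff_eq_inner by (rule L2_inner_cmult_left)

lemma L2_normsq_trig_sum:
  assumes "finite F" "F \<subseteq> multi_indices N"
  shows "L2_normsq N (\<lambda>\<zeta>. \<Sum>\<alpha>\<in>F. c \<alpha> * monomial N \<alpha> \<zeta>) = (\<Sum>\<alpha>\<in>F. (cmod (c \<alpha>))\<^sup>2)"
proof -
  let ?s = "\<lambda>\<zeta>. \<Sum>\<alpha>\<in>F. c \<alpha> * monomial N \<alpha> \<zeta>"
  have s: "?s \<in> L2 N" by (intro L2_sum L2_cmult L2_monomial)
  have "L2_inner N ?s ?s = (\<Sum>\<alpha>\<in>F. c \<alpha> * cnj (fourier_coeff N ?s \<alpha>))"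
    using s by (subst L2_inner_sum_left)
      (auto simp: L2_cmult L2_monomial L2_inner_cmult_left fourier_coeff_eq_inner L2_inner_commute[of N "monomial N _" ?s])
  also have "\<dots> = (\<Sum>\<alpha>\<in>F. c \<alpha> * cnj (c \<alpha>))"
    using assms by (intro sum.cong refl) (subst fourier_coeff_sum, auto)
  also have "\<dots> = of_real (\<Sum>\<alpha>\<in>F. (cmod (c \<alpha>))\<^sup>2)"
    by (simp add: mult_cnj_self)
  finally show ?thesis unfolding L2_inner_self of_real_eq_iff .
qed

lemma L2_normsq_diff_trig_sum:
  assumes f: "f \<in> L2 N" and F: "finite F" "F \<subseteq> multi_indices N"
  shows "L2_normsq N (\<lambda>\<zeta>. f \<zeta> - (\<Sum>\<alpha>\<in>F. fourier_coeff N f \<alpha> * monomial N \<alpha> \<zeta>))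
      = L2_normsq N f - (\<Sum>\<alpha>\<in>F. (cmod (fourier_coeff N f \<alpha>))\<^sup>2)"
proof -
  let ?s = "\<lambda>\<zeta>. \<Sum>\<alpha>\<in>F. fourier_coeff N f \<alpha> * monomial N \<alpha> \<zeta>"
  have s: "?s \<in> L2 N" by (intro L2_sum L2_cmult L2_monomial)
  have "L2_inner N ?s f = (\<Sum>\<alpha>\<in>F. fourier_coeff N f \<alpha> * cnj (fourier_coeff N f \<alpha>))"
    using f by (subst L2_inner_sum_left)
      (auto simp: L2_cmult L2_monomial L2_inner_cmult_left fourier_coeff_eq_inner L2_inner_commute[of N "monomial N _" f])
  also have "\<dots> = L2_normsq N ?s"
    by (simp add: L2_normsq_trig_sum F mult_cnj_self)
  finally have "L2_inner N ?s f = L2_normsq N ?s" .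
  hence "L2_inner N f ?s = 1 * complex_of_real (L2_normsq N ?s)"
    by (subst L2_inner_commute) simp
  from L2_normsq_diff_projection[OF f s this] show ?thesis
    by (simp add: L2_normsq_trig_sum F)
qed

lemma Bessel_finite:
  assumes "f \<in> L2 N" "finite F" "F \<subseteq> multi_indices N"
  shows "(\<Sum>\<alpha>\<in>F. (cmod (fourier_coeff N f \<alpha>))\<^sup>2) \<le> L2_normsq N f"
  using L2_normsq_diff_trig_sum[OF assms] L2_normsq_nonneg[of N "\<lambda>\<zeta>. f \<zeta> - (\<Sum>\<alpha>\<in>F. fourier_coeff N f \<alpha> * monomial N \<alpha> \<zeta>)"]
  by linarith

lemma Bessel_summable:
  assumes "f \<in> L2 N"
  shows "(\<lambda>\<alpha>. (cmod (fourier_coeff N f \<alpha>))\<^sup>2) summable_on multi_indices N"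
  by (rule nonneg_bdd_above_summable_on) (auto intro!: bdd_aboveI2[where M = "L2_normsq N f"] Bessel_finite assms)

section \<open>The theorems of Riesz-Fischer and Parseval\<close>

text \<open>
  Finite sets that exhaust a summable family at a prescribed rate. They replace passing to a
  rapidly converging subsequence in the proof of the Riesz-Fischer theorem.
\<close>
lemma summable_on_exhaustion:
  fixes g :: "'a \<Rightarrow> real"
  assumes "g summable_on J" "\<And>x. x \<in> J \<Longrightarrow> 0 \<le> g x" "\<And>n. 0 < (\<epsilon> n :: real)"
  obtains F where "\<And>n::nat. finite (F n)" "\<And>n. F n \<subseteq> J" "\<And>n. F n \<subseteq> F (Suc n)"
    "\<And>n E. finite E \<Longrightarrow> E \<subseteq> J \<Longrightarrow> E \<inter> F n = {} \<Longrightarrow> sum g E < \<epsilon> n"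
proof -
  have "\<exists>F. finite F \<and> F \<subseteq> J \<and> (\<forall>E. finite E \<and> E \<subseteq> J \<and> E \<inter> F = {} \<longrightarrow> sum g E < \<epsilon> n)" for n
  proof -
    have hs: "(g has_sum infsum g J) J" using assms(1) by simp
    obtain F where F: "finite F" "F \<subseteq> J" "dist (sum g F) (infsum g J) < \<epsilon> n"
      using hs[unfolded has_sum_def, THEN tendstoD, OF assms(3)[of n]]
      unfolding eventually_finite_subsets_at_top by blast
    have "sum g E < \<epsilon> n" if E: "finite E" "E \<subseteq> J" "E \<inter> F = {}" for E
    proof -
      have "sum g F + sum g E = sum g (F \<union> E)" using E F by (subst sum.union_disjoint) auto
      also have "\<dots> \<le> infsum g J" using E F assms
        by (intro finite_sum_le_infsum) auto
      finally show ?thesis using F(3) by (simp add: dist_real_def abs_if split: if_splits)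
    qed
    thus ?thesis using F by blast
  qed
  hence "\<forall>n. \<exists>F. finite F \<and> F \<subseteq> J \<and> (\<forall>E. finite E \<and> E \<subseteq> J \<and> E \<inter> F = {} \<longrightarrow> sum g E < \<epsilon> n)" by (rule allI)
  from choice[OF this] obtain F0 where F0:
    "\<forall>n. finite (F0 n) \<and> F0 n \<subseteq> J \<and> (\<forall>E. finite E \<and> E \<subseteq> J \<and> E \<inter> F0 n = {} \<longrightarrow> sum g E < \<epsilon> n)"
    by (rule exE)
  show ?thesis
  proof (rule that[of "\<lambda>n. \<Union>k\<le>n. F0 k"])
    show "sum g E < \<epsilon> n" if E: "finite E" "E \<subseteq> J" "E \<inter> (\<Union>k\<le>n. F0 k) = {}" for n E
    proof -
      have "E \<inter> F0 n = {}" using E(3) by blast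
      thus ?thesis using F0[rule_format, of n] E(1,2) by simp
    qed
    show "finite (\<Union>k\<le>n. F0 k)" for n using F0 by blast
    show "(\<Union>k\<le>n. F0 k) \<subseteq> J" for n using F0 by blast
    show "(\<Union>k\<le>n. F0 k) \<subseteq> (\<Union>k\<le>Suc n. F0 k)" for n by (auto simp: atMost_Suc)
  qed
qed

lemma L1_le_L2_norm:
  assumes "f \<in> L2 N"
  shows "(LINT \<zeta>|torus N. cmod (f \<zeta>)) \<le> sqrt (L2_normsq N f)"
proof -
  have m: "(\<lambda>\<zeta>. of_real (cmod (f \<zeta>))) \<in> L2 N" "(\<lambda>_. 1) \<in> L2 N"
    using assms by (auto simp: L2_def)
  have "L2_inner N (\<lambda>\<zeta>. of_real (cmod (f \<zeta>))) (\<lambda>_. 1) = of_real (LINT \<zeta>|torus N. cmod (f \<zeta>))"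
    by (simp add: L2_inner_def)
  hence "(LINT \<zeta>|torus N. cmod (f \<zeta>))\<^sup>2 \<le> L2_normsq N f"
    using L2_Cauchy_Schwarz[OF m] by (simp add: L2_normsq_def torus.prob_space)
  thus ?thesis by (rule real_le_rsqrt)
qed

text \<open>
  The partial Fourier sums over suitable finite sets differ by functions whose \<open>L\<^sup>2\<close> norms, hence
  also \<open>L\<^sup>1\<close> norms, decay geometrically. The telescoping series therefore converges almost
  everywhere and in \<open>L\<^sup>1\<close>, the latter giving the coefficients of the limit; Fatou's lemma
  bounds its \<open>L\<^sup>2\<close> norm. This bound, the reverse of Bessel's inequality, is what later upgrades
  Bessel to Parseval.
\<close>
theorem Riesz_Fischer:
  assumes sum: "(\<lambda>\<alpha>. (cmod (c \<alpha>))\<^sup>2) summable_on multi_indices N"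
  obtains f where "f \<in> L2 N" "\<And>\<alpha>. \<alpha> \<in> multi_indices N \<Longrightarrow> fourier_coeff N f \<alpha> = c \<alpha>"
    "L2_normsq N f \<le> (\<Sum>\<^sub>\<infinity>\<alpha>\<in>multi_indices N. (cmod (c \<alpha>))\<^sup>2)"
proof -
  let ?J = "multi_indices N" and ?g = "\<lambda>\<alpha>. (cmod (c \<alpha>))\<^sup>2"
  obtain F where fin: "\<And>n. finite (F n)" and FJ: "\<And>n. F n \<subseteq> ?J" and mono: "\<And>n. F n \<subseteq> F (Suc n)"
    and tail: "\<And>n E. finite E \<Longrightarrow> E \<subseteq> ?J \<Longrightarrow> E \<inter> F n = {} \<Longrightarrow> sum ?g E < (1/4) ^ n"
    by (rule summable_on_exhaustion[OF sum, of "\<lambda>n. (1/4)^n"]) (simp, simp, rule that)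
  \<comment> \<open>blocks of the exhaustion: the sums \<open>d n\<close> over them telescope to the partial sums \<open>s n\<close>\<close>
  define D where "D n = (case n of 0 \<Rightarrow> F 0 | Suc m \<Rightarrow> F (Suc m) - F m)" for n
  define d where "d n \<zeta> = (\<Sum>\<alpha>\<in>D n. c \<alpha> * monomial N \<alpha> \<zeta>)" for n \<zeta>
  define s where "s n \<zeta> = (\<Sum>\<alpha>\<in>F n. c \<alpha> * monomial N \<alpha> \<zeta>)" for n \<zeta>
  have finD: "finite (D n)" and DJ: "D n \<subseteq> ?J" for n
    using fin FJ by (auto simp: D_def split: nat.splits)
  have d_L2: "d n \<in> L2 N" for n unfolding d_def by (intro L2_sum L2_cmult L2_monomial)
  have s_L2: "s n \<in> L2 N" for n unfolding s_def by (intro L2_sum L2_cmult L2_monomial)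
  have s_sum: "(\<Sum>k\<le>n. d k \<zeta>) = s n \<zeta>" for n \<zeta>
  proof (induction n)
    case 0
    show ?case by (simp add: d_def s_def D_def)
  next
    case (Suc n)
    have "s (Suc n) \<zeta> = (\<Sum>\<alpha>\<in>F (Suc n) - F n. c \<alpha> * monomial N \<alpha> \<zeta>) + s n \<zeta>"
      unfolding s_def using fin mono by (intro sum.subset_diff) auto
    with Suc show ?case by (simp add: d_def D_def)
  qed
  have d_L1: "(LINT \<zeta>|torus N. cmod (d (Suc n) \<zeta>)) \<le> (1/2) ^ n" for n
  proof -
    have "L2_normsq N (d (Suc n)) = sum ?g (D (Suc n))"
      unfolding d_def by (rule L2_normsq_trig_sum[OF finD DJ])
    also have "\<dots> \<le> (1/4) ^ n"
      by (intro less_imp_le tail finD DJ) (auto simp: D_def)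
    also have "(1/4) ^ n = ((1/2 :: real) ^ n)\<^sup>2" by (simp add: power2_eq_square flip: power_mult_distrib)
    finally have "sqrt (L2_normsq N (d (Suc n))) \<le> (1/2) ^ n"
      by (intro real_le_lsqrt) auto
    with L1_le_L2_norm[OF d_L2] show ?thesis by (rule order_trans)
  qed
  have d_summable: "summable (\<lambda>n. LINT \<zeta>|torus N. cmod (d n \<zeta>))"
  proof -
    have "summable (\<lambda>n. LINT \<zeta>|torus N. cmod (d (Suc n) \<zeta>))"
      by (rule summable_comparison_test[OF _ summable_geometric[of "1/2"]])
         (use d_L1 in \<open>auto intro!: exI[of _ 0] simp: integral_nonneg_AE\<close>)
    thus ?thesis by (subst (asm) summable_Suc_iff)
  qed
  have d_int: "integrable (torus N) (d n)" for n by (rule L2_integrable[OF d_L2])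
  have d_meas [measurable]: "d n \<in> borel_measurable (torus N)" for n using d_int by auto
  have AE_summable: "AE \<zeta> in torus N. summable (\<lambda>n. cmod (d n \<zeta>))"
  proof -
    have "(\<integral>\<^sup>+\<zeta>. (\<Sum>n. ennreal (cmod (d n \<zeta>))) \<partial>torus N) = (\<Sum>n. \<integral>\<^sup>+\<zeta>. ennreal (cmod (d n \<zeta>)) \<partial>torus N)"
      by (rule nn_integral_suminf) measurable
    also have "\<dots> = (\<Sum>n. ennreal (LINT \<zeta>|torus N. cmod (d n \<zeta>)))"
      using d_int by (intro suminf_cong nn_integral_eq_integral) auto
    also have "\<dots> = ennreal (\<Sum>n. LINT \<zeta>|torus N. cmod (d n \<zeta>))"
      by (intro suminf_ennreal2 d_summable) auto
    finally have "(\<integral>\<^sup>+\<zeta>. (\<Sum>n. ennreal (cmod (d n \<zeta>))) \<partial>torus N) \<noteq> \<infinity>" by simp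
    hence "AE \<zeta> in torus N. (\<Sum>n. ennreal (cmod (d n \<zeta>))) \<noteq> \<infinity>"
      by (intro nn_integral_PInf_AE) auto
    thus ?thesis by eventually_elim (rule summable_suminf_not_top, auto)
  qed
  define f where "f \<zeta> = (\<Sum>n. d n \<zeta>)" for \<zeta>
  have f_meas [measurable]: "f \<in> borel_measurable (torus N)" unfolding f_def by measurable
  have s_lim: "AE \<zeta> in torus N. (\<lambda>n. s n \<zeta>) \<longlonglongrightarrow> f \<zeta>"
    using AE_summable
  proof eventually_elim
    case (elim \<zeta>)
    hence "(\<lambda>n. d n \<zeta>) sums f \<zeta>" unfolding f_def by (rule summable_sums[OF summable_norm_cancel])
    thus ?case unfolding sums_def_le s_sum .
  qed
  have f_bound: "(\<integral>\<^sup>+\<zeta>. ennreal ((cmod (f \<zeta>))\<^sup>2) \<partial>torus N) \<le> ennreal (infsum ?g ?J)"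
  proof -
    have "(\<integral>\<^sup>+\<zeta>. ennreal ((cmod (f \<zeta>))\<^sup>2) \<partial>torus N) = (\<integral>\<^sup>+\<zeta>. liminf (\<lambda>n. ennreal ((cmod (s n \<zeta>))\<^sup>2)) \<partial>torus N)"
    proof (rule nn_integral_cong_AE)
      show "AE \<zeta> in torus N. ennreal ((cmod (f \<zeta>))\<^sup>2) = liminf (\<lambda>n. ennreal ((cmod (s n \<zeta>))\<^sup>2))"
        using s_lim
      proof eventually_elim
        case (elim \<zeta>)
        hence "(\<lambda>n. ennreal ((cmod (s n \<zeta>))\<^sup>2)) \<longlonglongrightarrow> ennreal ((cmod (f \<zeta>))\<^sup>2)"
          by (intro tendsto_ennrealI tendsto_intros)
        thus ?case by (intro lim_imp_Liminf[symmetric]) auto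
      qed
    qed
    also have "\<dots> \<le> liminf (\<lambda>n. \<integral>\<^sup>+\<zeta>. ennreal ((cmod (s n \<zeta>))\<^sup>2) \<partial>torus N)"
      using s_L2 by (intro nn_integral_liminf) (auto dest: L2_measurable)
    also have "\<dots> \<le> ennreal (infsum ?g ?J)"
    proof (rule Liminf_le)
      have "(\<integral>\<^sup>+\<zeta>. ennreal ((cmod (s n \<zeta>))\<^sup>2) \<partial>torus N) \<le> ennreal (infsum ?g ?J)" for n
      proof -
        have "(\<integral>\<^sup>+\<zeta>. ennreal ((cmod (s n \<zeta>))\<^sup>2) \<partial>torus N) = ennreal (L2_normsq N (s n))"
          unfolding L2_normsq_def using s_L2[of n] by (intro nn_integral_eq_integral) (auto simp: L2_def)
        also have "L2_normsq N (s n) = sum ?g (F n)"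
          unfolding s_def by (rule L2_normsq_trig_sum[OF fin FJ])
        also have "\<dots> \<le> infsum ?g ?J"
          using fin FJ by (intro finite_sum_le_infsum sum) auto
        finally show ?thesis by (simp add: ennreal_leI)
      qed
      thus "\<forall>\<^sub>F n in sequentially. (\<integral>\<^sup>+\<zeta>. ennreal ((cmod (s n \<zeta>))\<^sup>2) \<partial>torus N) \<le> ennreal (infsum ?g ?J)"
        by simp
    qed simp
    finally show ?thesis .
  qed
  have f_int: "integrable (torus N) (\<lambda>\<zeta>. (cmod (f \<zeta>))\<^sup>2)"
    using le_less_trans[OF f_bound] by (intro integrableI_bounded) auto
  hence f_L2: "f \<in> L2 N" by (simp add: L2_def)
  have f_norm: "L2_normsq N f \<le> infsum ?g ?J"
    using f_bound f_int unfolding L2_normsq_def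
    by (subst (asm) nn_integral_eq_integral) (auto simp: infsum_nonneg)
  have "fourier_coeff N f \<alpha> = c \<alpha>" if \<alpha>: "\<alpha> \<in> ?J" for \<alpha>
  proof -
    let ?m = "monomial N (\<lambda>j. - \<alpha> j)"
    have "(\<lambda>n. LINT \<zeta>|torus N. d n \<zeta> * ?m \<zeta>) sums (LINT \<zeta>|torus N. (\<Sum>n. d n \<zeta> * ?m \<zeta>))"
    proof (rule sums_integral)
      show "integrable (torus N) (\<lambda>\<zeta>. d n \<zeta> * ?m \<zeta>)" for n
        by (intro integrable_mult_L2 d_L2 L2_monomial)
      show "AE \<zeta> in torus N. summable (\<lambda>n. norm (d n \<zeta> * ?m \<zeta>))"
        using AE_summable AE_space by eventually_elim (simp add: norm_mult norm_monomial)
      have "(LINT \<zeta>|torus N. norm (d n \<zeta> * ?m \<zeta>)) = (LINT \<zeta>|torus N. cmod (d n \<zeta>))" for n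
        by (intro Bochner_Integration.integral_cong) (auto simp: norm_mult norm_monomial)
      thus "summable (\<lambda>n. LINT \<zeta>|torus N. norm (d n \<zeta> * ?m \<zeta>))"
        using d_summable by simp
    qed
    also have "(LINT \<zeta>|torus N. (\<Sum>n. d n \<zeta> * ?m \<zeta>)) = fourier_coeff N f \<alpha>"
      unfolding fourier_coeff_def
    proof (rule integral_cong_AE)
      show "AE \<zeta> in torus N. (\<Sum>n. d n \<zeta> * ?m \<zeta>) = f \<zeta> * ?m \<zeta>"
        using AE_summable unfolding f_def
        by eventually_elim (rule suminf_mult2[OF summable_norm_cancel, symmetric])
    qed measurable
    also have "(\<lambda>n. LINT \<zeta>|torus N. d n \<zeta> * ?m \<zeta>) = (\<lambda>n. if \<alpha> \<in> D n then c \<alpha> else 0)"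
      unfolding fourier_coeff_def[symmetric] d_def
      by (intro ext fourier_coeff_sum finD DJ \<alpha>)
    finally have sums: "(\<lambda>n. if \<alpha> \<in> D n then c \<alpha> else 0) sums fourier_coeff N f \<alpha>" .
    have part: "(\<Sum>k\<le>n. if \<alpha> \<in> D k then c \<alpha> else 0) = (if \<alpha> \<in> F n then c \<alpha> else 0)" for n
      using mono by (induction n) (auto simp: D_def)
    have "(\<lambda>n. if \<alpha> \<in> F n then c \<alpha> else 0) \<longlonglongrightarrow> fourier_coeff N f \<alpha>"
      using sums unfolding sums_def_le part .
    moreover have "(\<lambda>n. if \<alpha> \<in> F n then c \<alpha> else 0) \<longlonglongrightarrow> c \<alpha>"
    proof (cases "\<exists>n. \<alpha> \<in> F n")
      case True
      then obtain n where n: "\<alpha> \<in> F n" by blast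
      have "\<alpha> \<in> F m" if "m \<ge> n" for m using lift_Suc_mono_le[of F, OF mono that] n by blast
      thus ?thesis by (intro tendsto_eventually) (auto simp: eventually_at_top_linorder)
    next
      case False
      \<comment> \<open>an index that is never reached lies in every tail, so its coefficient vanishes\<close>
      have "?g \<alpha> < (1/4) ^ n" for n using tail[of "{\<alpha>}" n] \<alpha> False by simp
      hence "?g \<alpha> \<le> 0"
        by (intro LIMSEQ_le_const[OF LIMSEQ_power_zero[of "1/4::real"]]) (auto intro: less_imp_le)
      thus ?thesis using False by simp
    qed
    ultimately show ?thesis by (rule LIMSEQ_unique)
  qed
  thus ?thesis by (rule that[OF f_L2 _ f_norm])
qed

lemma L2_AE_eqI:
  assumes "f \<in> L2 N" "g \<in> L2 N" "\<And>\<alpha>. \<alpha> \<in> multi_indices N \<Longrightarrow> fourier_coeff N f \<alpha> = fourier_coeff N g \<alpha>"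
  shows "AE \<zeta> in torus N. f \<zeta> = g \<zeta>"
proof -
  have "AE \<zeta> in torus N. f \<zeta> - g \<zeta> = 0"
  proof (rule fourier_uniqueness)
    show "integrable (torus N) (\<lambda>\<zeta>. f \<zeta> - g \<zeta>)" by (intro L2_integrable L2_diff assms)
    show "fourier_coeff N (\<lambda>\<zeta>. f \<zeta> - g \<zeta>) \<alpha> = 0" for \<alpha>
      using assms(3)[OF restrict_in_multi_indices] assms(1,2)
      by (simp add: fourier_coeff_diff fourier_coeff_restrict)
  qed
  thus ?thesis by eventually_elim simp
qed

text \<open>
  The function built from the coefficients of \<open>f\<close> by the Riesz-Fischer theorem equals \<open>f\<close> almost
  everywhere by uniqueness, and its squared norm is at most the sum; Bessel gives the converse.
\<close>
theorem Parseval: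
  assumes f: "f \<in> L2 N"
  shows "((\<lambda>\<alpha>. (cmod (fourier_coeff N f \<alpha>))\<^sup>2) has_sum L2_normsq N f) (multi_indices N)"
proof -
  let ?g = "\<lambda>\<alpha>. (cmod (fourier_coeff N f \<alpha>))\<^sup>2" and ?J = "multi_indices N"
  have sum: "?g summable_on ?J" by (rule Bessel_summable[OF f])
  obtain g where g: "g \<in> L2 N" "\<And>\<alpha>. \<alpha> \<in> ?J \<Longrightarrow> fourier_coeff N g \<alpha> = fourier_coeff N f \<alpha>"
    and le: "L2_normsq N g \<le> infsum ?g ?J"
    using Riesz_Fischer[OF sum] by blast
  have "L2_normsq N f = L2_normsq N g"
    using f g by (intro L2_normsq_cong_AE L2_AE_eqI) auto
  moreover have "infsum ?g ?J \<le> L2_normsq N f"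
    by (rule infsum_le_finite_sums[OF sum]) (rule Bessel_finite[OF f])
  ultimately have "infsum ?g ?J = L2_normsq N f" using le by simp
  thus ?thesis using has_sum_infsum[OF sum] by simp
qed

lemma complex_polarisation:
  "4 * (z * cnj w) = of_real ((cmod (z + w))\<^sup>2) - of_real ((cmod (z - w))\<^sup>2)
     + \<i> * (of_real ((cmod (z + \<i> * w))\<^sup>2) - of_real ((cmod (z - \<i> * w))\<^sup>2))"
  unfolding cmod_power2 by (simp add: complex_eq_iff power2_eq_square algebra_simps)

corollary Parseval_inner:
  assumes f: "f \<in> L2 N" and g: "g \<in> L2 N"
  shows "((\<lambda>\<alpha>. fourier_coeff N f \<alpha> * cnj (fourier_coeff N g \<alpha>)) has_sum L2_inner N f g) (multi_indices N)"
proof -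
  have ig: "(\<lambda>\<zeta>. \<i> * g \<zeta>) \<in> L2 N" by (rule L2_cmult[OF g])
  have P: "((\<lambda>\<alpha>. complex_of_real ((cmod (fourier_coeff N h \<alpha>))\<^sup>2)) has_sum of_real (L2_normsq N h)) (multi_indices N)"
    if "h \<in> L2 N" for h
    using Parseval[OF that] by (rule has_sum_of_real)
  have normsq_integral: "complex_of_real (L2_normsq N h) = (LINT \<zeta>|torus N. complex_of_real ((cmod (h \<zeta>))\<^sup>2))" for h
    unfolding L2_normsq_def by (rule integral_complex_of_real[symmetric])
  have I: "integrable (torus N) (\<lambda>\<zeta>. complex_of_real ((cmod (h \<zeta>))\<^sup>2))" if "h \<in> L2 N" for h
    using that by (simp add: L2_def del: of_real_power)
  have diff: "((\<lambda>\<alpha>. u \<alpha> - v \<alpha>) has_sum (a - b)) A" if "(u has_sum a) A" "(v has_sum b) A"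
    for u v :: "(nat \<Rightarrow> int) \<Rightarrow> complex" and a b A
    using has_sum_add[OF that(1) has_sum_cmult_right[OF that(2), of "-1"]] by simp
  have S: "((\<lambda>\<alpha>. 4 * (fourier_coeff N f \<alpha> * cnj (fourier_coeff N g \<alpha>))) has_sum
      (of_real (L2_normsq N (\<lambda>\<zeta>. f \<zeta> + g \<zeta>)) - of_real (L2_normsq N (\<lambda>\<zeta>. f \<zeta> - g \<zeta>))
     + \<i> * (of_real (L2_normsq N (\<lambda>\<zeta>. f \<zeta> + \<i> * g \<zeta>)) - of_real (L2_normsq N (\<lambda>\<zeta>. f \<zeta> - \<i> * g \<zeta>))))) (multi_indices N)"
    using has_sum_add[OF diff[OF P[OF L2_add[OF f g]] P[OF L2_diff[OF f g]]]
      has_sum_cmult_right[OF diff[OF P[OF L2_add[OF f ig]] P[OF L2_diff[OF f ig]]], of \<i>]]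
    unfolding fourier_coeff_add[OF f g] fourier_coeff_diff[OF f g] fourier_coeff_add[OF f ig]
      fourier_coeff_diff[OF f ig] fourier_coeff_cmult complex_polarisation .
  have "of_real (L2_normsq N (\<lambda>\<zeta>. f \<zeta> + g \<zeta>)) - of_real (L2_normsq N (\<lambda>\<zeta>. f \<zeta> - g \<zeta>))
     + \<i> * (of_real (L2_normsq N (\<lambda>\<zeta>. f \<zeta> + \<i> * g \<zeta>)) - of_real (L2_normsq N (\<lambda>\<zeta>. f \<zeta> - \<i> * g \<zeta>)))
     = (LINT \<zeta>|torus N. 4 * (f \<zeta> * cnj (g \<zeta>)))"
    unfolding complex_polarisation normsq_integral
    using I[OF L2_add[OF f g]] I[OF L2_diff[OF f g]] I[OF L2_add[OF f ig]] I[OF L2_diff[OF f ig]]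
    by (simp del: of_real_power)
  also have "\<dots> = 4 * L2_inner N f g" by (simp add: L2_inner_def)
  finally have "((\<lambda>\<alpha>. 4 * (fourier_coeff N f \<alpha> * cnj (fourier_coeff N g \<alpha>))) has_sum 4 * L2_inner N f g) (multi_indices N)"
    using S by simp
  from has_sum_cmult_right[OF this, of "1/4"] show ?thesis by simp
qed

section \<open>The orthogonal projection onto the Hardy space\<close>

lemma H2_iff:
  "f \<in> H2 N \<longleftrightarrow> f \<in> L2 N \<and> (\<forall>\<alpha>\<in>multi_indices N - nonneg_multi_indices N. fourier_coeff N f \<alpha> = 0)"
proof
  assume "f \<in> H2 N"
  thus "f \<in> L2 N \<and> (\<forall>\<alpha>\<in>multi_indices N - nonneg_multi_indices N. fourier_coeff N f \<alpha> = 0)"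
    by (auto simp: H2_def multi_indices_def nonneg_multi_indices_def PiE_iff)
next
  assume f: "f \<in> L2 N \<and> (\<forall>\<alpha>\<in>multi_indices N - nonneg_multi_indices N. fourier_coeff N f \<alpha> = 0)"
  have "fourier_coeff N f \<alpha> = 0" if "\<not> (\<forall>j<N. 0 \<le> \<alpha> j)" for \<alpha>
    using f that restrict_in_multi_indices[of \<alpha> N] restrict_in_nonneg_multi_indices[of \<alpha> N]
    by (metis DiffI fourier_coeff_restrict)
  with f show "f \<in> H2 N" by (simp add: H2_def)
qed

lemma H2_L2: "f \<in> H2 N \<Longrightarrow> f \<in> L2 N"
  by (simp add: H2_def)

text \<open>
  Elements of the Hardy space are functions rather than classes, so the orthogonal projection is
  a choice of representative. Its Fourier coefficients determine it almost everywhere.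
\<close>
definition H2_proj :: "nat \<Rightarrow> ((nat \<Rightarrow> complex) \<Rightarrow> complex) \<Rightarrow> (nat \<Rightarrow> complex) \<Rightarrow> complex" where
  "H2_proj N f = (SOME g. g \<in> L2 N \<and> (\<forall>\<alpha>\<in>multi_indices N.
      fourier_coeff N g \<alpha> = (if \<alpha> \<in> nonneg_multi_indices N then fourier_coeff N f \<alpha> else 0)))"

lemma H2_proj:
  assumes "f \<in> L2 N"
  shows H2_proj_in_H2: "H2_proj N f \<in> H2 N"
    and fourier_coeff_H2_proj: "\<And>\<alpha>. \<alpha> \<in> multi_indices N \<Longrightarrow>
      fourier_coeff N (H2_proj N f) \<alpha> = (if \<alpha> \<in> nonneg_multi_indices N then fourier_coeff N f \<alpha> else 0)"
proof -
  let ?c = "\<lambda>\<alpha>. if \<alpha> \<in> nonneg_multi_indices N then fourier_coeff N f \<alpha> else 0"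
  have "(\<lambda>\<alpha>. (cmod (?c \<alpha>))\<^sup>2) summable_on multi_indices N"
    by (rule summable_on_comparison_test[OF Bessel_summable[OF assms]]) auto
  then obtain g where "g \<in> L2 N" "\<And>\<alpha>. \<alpha> \<in> multi_indices N \<Longrightarrow> fourier_coeff N g \<alpha> = ?c \<alpha>"
    by (rule Riesz_Fischer) blast
  hence "\<exists>g. g \<in> L2 N \<and> (\<forall>\<alpha>\<in>multi_indices N. fourier_coeff N g \<alpha> = ?c \<alpha>)" by blast
  from someI_ex[OF this] have P: "H2_proj N f \<in> L2 N" "\<forall>\<alpha>\<in>multi_indices N. fourier_coeff N (H2_proj N f) \<alpha> = ?c \<alpha>"
    unfolding H2_proj_def by blast+
  show "H2_proj N f \<in> H2 N" unfolding H2_iff using P by auto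
  show "\<And>\<alpha>. \<alpha> \<in> multi_indices N \<Longrightarrow> fourier_coeff N (H2_proj N f) \<alpha> = ?c \<alpha>"
    using P(2) by blast
qed

text \<open>
  Both inner products are the same Parseval series, because the coefficients of \<open>g\<close> vanish at
  all indices where those of \<open>f\<close> are changed.
\<close>
lemma H2_proj_inner:
  assumes "f \<in> L2 N" "g \<in> H2 N"
  shows "L2_inner N (H2_proj N f) g = L2_inner N f g"
proof -
  have "((\<lambda>\<alpha>. fourier_coeff N (H2_proj N f) \<alpha> * cnj (fourier_coeff N g \<alpha>)) has_sum L2_inner N (H2_proj N f) g) (multi_indices N)"
    by (rule Parseval_inner[OF H2_L2[OF H2_proj_in_H2[OF assms(1)]] H2_L2[OF assms(2)]])
  also have "?this \<longleftrightarrow> ((\<lambda>\<alpha>. fourier_coeff N f \<alpha> * cnj (fourier_coeff N g \<alpha>)) has_sum L2_inner N (H2_proj N f) g) (multi_indices N)"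
    using assms by (intro has_sum_cong) (auto simp: fourier_coeff_H2_proj H2_iff)
  finally show ?thesis
    using Parseval_inner[OF assms(1) H2_L2[OF assms(2)]] by (rule has_sum_unique)
qed

lemma H2_proj_normsq:
  assumes "f \<in> L2 N"
  shows "((\<lambda>\<alpha>. (cmod (fourier_coeff N f \<alpha>))\<^sup>2) has_sum L2_normsq N (H2_proj N f)) (nonneg_multi_indices N)"
proof -
  have "((\<lambda>\<alpha>. (cmod (fourier_coeff N (H2_proj N f) \<alpha>))\<^sup>2) has_sum L2_normsq N (H2_proj N f)) (multi_indices N)"
    by (rule Parseval[OF H2_L2[OF H2_proj_in_H2[OF assms]]])
  also have "?this \<longleftrightarrow> ?thesis"
    using assms nonneg_multi_indices_subset[of N]
    by (intro has_sum_cong_neutral) (auto simp: fourier_coeff_H2_proj)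
  finally show ?thesis .
qed

section \<open>Multiplication by bounded analytic functions\<close>

lemma H2_coeff_eq_0: "f \<in> H2 N \<Longrightarrow> \<not> (\<forall>j<N. 0 \<le> \<alpha> j) \<Longrightarrow> fourier_coeff N f \<alpha> = 0"
  by (simp add: H2_def)

lemma Hinf_iff: "\<phi> \<in> Hinf N \<longleftrightarrow> \<phi> \<in> H2 N \<and> (\<exists>B. AE \<zeta> in torus N. cmod (\<phi> \<zeta>) \<le> B)"
proof
  assume \<phi>: "\<phi> \<in> Hinf N"
  hence "Linf_norm N \<phi> \<noteq> \<infinity>" by (auto simp: Hinf_def Linf_def)
  then obtain n :: nat where n: "Linf_norm N \<phi> < ereal (real n)"
    unfolding less_PInf_Ex_of_nat by blast
  have "AE \<zeta> in torus N. ereal (cmod (\<phi> \<zeta>)) \<le> Linf_norm N \<phi>"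
    unfolding Linf_norm_def by (rule esssup_AE)
  hence "AE \<zeta> in torus N. cmod (\<phi> \<zeta>) \<le> real n"
  proof eventually_elim
    case (elim \<zeta>)
    from le_less_trans[OF elim n] show ?case by simp
  qed
  with \<phi> show "\<phi> \<in> H2 N \<and> (\<exists>B. AE \<zeta> in torus N. cmod (\<phi> \<zeta>) \<le> B)"
    by (auto simp: Hinf_def)
next
  assume "\<phi> \<in> H2 N \<and> (\<exists>B. AE \<zeta> in torus N. cmod (\<phi> \<zeta>) \<le> B)"
  then obtain B where \<phi>: "\<phi> \<in> H2 N" and B: "AE \<zeta> in torus N. cmod (\<phi> \<zeta>) \<le> B" by blast
  have m: "\<phi> \<in> borel_measurable (torus N)" using \<phi> by (intro L2_measurable H2_L2)
  have "Linf_norm N \<phi> \<le> ereal B"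
    unfolding Linf_norm_def using m B by (intro esssup_I) auto
  also have "\<dots> < \<infinity>" by simp
  finally show "\<phi> \<in> Hinf N" using \<phi> m by (simp add: Hinf_def Linf_def)
qed

lemma Hinf_H2: "\<phi> \<in> Hinf N \<Longrightarrow> \<phi> \<in> H2 N"
  by (simp add: Hinf_iff)

lemma Hinf_L2: "\<phi> \<in> Hinf N \<Longrightarrow> \<phi> \<in> L2 N"
  by (intro H2_L2 Hinf_H2)

lemma Hinf_mult_L2:
  assumes "\<phi> \<in> Hinf N" "g \<in> L2 N"
  shows "(\<lambda>\<zeta>. \<phi> \<zeta> * g \<zeta>) \<in> L2 N" "(\<lambda>\<zeta>. cnj (\<phi> \<zeta>) * g \<zeta>) \<in> L2 N"
proof -
  obtain B where B: "AE \<zeta> in torus N. cmod (\<phi> \<zeta>) \<le> B" using assms by (auto simp: Hinf_iff)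
  have m: "\<phi> \<in> borel_measurable (torus N)" using assms by (intro L2_measurable Hinf_L2)
  show "(\<lambda>\<zeta>. \<phi> \<zeta> * g \<zeta>) \<in> L2 N" "(\<lambda>\<zeta>. cnj (\<phi> \<zeta>) * g \<zeta>) \<in> L2 N"
    using B m by (auto intro!: L2_mult_AE_bounded[OF assms(2), where B = B] borel_measurable_cnj)
qed

lemma L2_inner_mult_right:
  "L2_inner N f (\<lambda>\<zeta>. \<phi> \<zeta> * g \<zeta>) = L2_inner N (\<lambda>\<zeta>. cnj (\<phi> \<zeta>) * f \<zeta>) g"
  unfolding L2_inner_def by (simp add: mult_ac)

text \<open>
  The Cauchy product formula. The Parseval series for the pairing of \<open>g\<close> with
  \<open>cnj \<phi> * monomial N \<gamma>\<close> is a convolution over all of \<open>\<int>\<^sup>N\<close>; analyticity of both factors leaves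
  only the box between \<open>0\<close> and \<open>\<gamma>\<close>. In particular nothing is left when \<open>\<gamma>\<close> has a negative entry,
  which is why analytic functions are closed under such products.
\<close>
lemma fourier_coeff_mult:
  assumes \<phi>: "\<phi> \<in> Hinf N" and g: "g \<in> H2 N"
  shows "fourier_coeff N (\<lambda>\<zeta>. \<phi> \<zeta> * g \<zeta>) \<gamma> =
    (\<Sum>\<delta>\<in>PiE {..<N} (\<lambda>j. {0..\<gamma> j}). fourier_coeff N \<phi> (\<lambda>j. \<gamma> j - \<delta> j) * fourier_coeff N g \<delta>)"
proof -
  let ?h = "\<lambda>\<zeta>. cnj (\<phi> \<zeta>) * monomial N \<gamma> \<zeta>"
  let ?D = "PiE {..<N} (\<lambda>j. {0..\<gamma> j})"
  let ?t = "\<lambda>\<delta>. fourier_coeff N \<phi> (\<lambda>j. \<gamma> j - \<delta> j) * fourier_coeff N g \<delta>"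
  have h: "?h \<in> L2 N" by (rule Hinf_mult_L2(2)[OF \<phi> L2_monomial])
  have coeff: "fourier_coeff N ?h \<delta> = cnj (fourier_coeff N \<phi> (\<lambda>j. \<gamma> j - \<delta> j))" for \<delta>
  proof -
    have "fourier_coeff N ?h \<delta> = (LINT \<zeta>|torus N. cnj (\<phi> \<zeta> * monomial N (\<lambda>j. - (\<gamma> j - \<delta> j)) \<zeta>))"
      unfolding fourier_coeff_def
    proof (intro Bochner_Integration.integral_cong refl)
      fix \<zeta> assume "\<zeta> \<in> space (torus N)"
      thus "?h \<zeta> * monomial N (\<lambda>j. - \<delta> j) \<zeta> = cnj (\<phi> \<zeta> * monomial N (\<lambda>j. - (\<gamma> j - \<delta> j)) \<zeta>)"
        by (simp add: cnj_monomial monomial_mult mult.assoc)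
    qed
    also have "\<dots> = cnj (fourier_coeff N \<phi> (\<lambda>j. \<gamma> j - \<delta> j))"
      unfolding fourier_coeff_def by (rule Bochner_Integration.integral_cnj)
    finally show ?thesis .
  qed
  have "L2_inner N g ?h = fourier_coeff N (\<lambda>\<zeta>. \<phi> \<zeta> * g \<zeta>) \<gamma>"
    unfolding fourier_coeff_eq_inner by (subst L2_inner_mult_right) simp
  with Parseval_inner[OF H2_L2[OF g] h]
  have "(?t has_sum fourier_coeff N (\<lambda>\<zeta>. \<phi> \<zeta> * g \<zeta>) \<gamma>) (multi_indices N)"
    by (simp add: coeff mult.commute)
  also have "?this \<longleftrightarrow> (?t has_sum fourier_coeff N (\<lambda>\<zeta>. \<phi> \<zeta> * g \<zeta>) \<gamma>) ?D"
  proof (rule has_sum_cong_neutral)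
    fix \<delta> assume \<delta>: "\<delta> \<in> multi_indices N - ?D"
    then obtain j where "j < N" "\<delta> j < 0 \<or> \<delta> j > \<gamma> j"
      by (auto simp: multi_indices_def PiE_iff not_le)
    thus "?t \<delta> = 0"
    proof (elim disjE)
      assume "\<delta> j < 0"
      hence "fourier_coeff N g \<delta> = 0"
        using \<open>j < N\<close> by (intro H2_coeff_eq_0[OF g]) (auto simp: not_le)
      thus ?thesis by simp
    next
      assume "\<delta> j > \<gamma> j"
      hence "\<not> (\<forall>j<N. 0 \<le> \<gamma> j - \<delta> j)" using \<open>j < N\<close> by (auto simp: not_le)
      hence "fourier_coeff N \<phi> (\<lambda>j. \<gamma> j - \<delta> j) = 0"
        by (rule H2_coeff_eq_0[OF Hinf_H2[OF \<phi>]])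
      thus ?thesis by simp
    qed
  qed (auto simp: multi_indices_def PiE_iff)
  finally have "(?t has_sum fourier_coeff N (\<lambda>\<zeta>. \<phi> \<zeta> * g \<zeta>) \<gamma>) ?D" .
  moreover have "(?t has_sum sum ?t ?D) ?D"
    by (intro has_sum_finite finite_PiE) auto
  ultimately show ?thesis by (rule has_sum_unique)
qed

lemma Hinf_mult_H2:
  assumes \<phi>: "\<phi> \<in> Hinf N" and g: "g \<in> H2 N"
  shows "(\<lambda>\<zeta>. \<phi> \<zeta> * g \<zeta>) \<in> H2 N"
proof -
  have "fourier_coeff N (\<lambda>\<zeta>. \<phi> \<zeta> * g \<zeta>) \<alpha> = 0" if "\<not> (\<forall>j<N. 0 \<le> \<alpha> j)" for \<alpha>
  proof -
    have "PiE {..<N} (\<lambda>j. {0..\<alpha> j}) = {}"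
      using that by (subst PiE_eq_empty_iff) auto
    thus ?thesis unfolding fourier_coeff_mult[OF assms] by simp
  qed
  with Hinf_mult_L2(1)[OF \<phi> H2_L2[OF g]] show ?thesis by (simp add: H2_def)
qed

lemma one_Hinf: "(\<lambda>_. 1) \<in> Hinf N"
proof -
  have "(\<lambda>_. 1) = monomial N (\<lambda>_. 0)" by (simp add: fun_eq_iff)
  moreover have "fourier_coeff N (monomial N (\<lambda>_. 0)) \<alpha> = 0" if "\<not> (\<forall>j<N. 0 \<le> \<alpha> j)" for \<alpha>
    using that by (auto simp: fourier_coeff_def integral_monomial)
  ultimately have "(\<lambda>_. 1) \<in> H2 N" using L2_monomial[of N "\<lambda>_. 0"] by (auto simp: H2_def)
  thus ?thesis by (auto simp: Hinf_iff)
qed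

lemma Hinf_mult:
  assumes "\<phi> \<in> Hinf N" "\<psi> \<in> Hinf N"
  shows "(\<lambda>\<zeta>. \<phi> \<zeta> * \<psi> \<zeta>) \<in> Hinf N"
proof -
  obtain B C where B: "AE \<zeta> in torus N. cmod (\<phi> \<zeta>) \<le> B" and C: "AE \<zeta> in torus N. cmod (\<psi> \<zeta>) \<le> C"
    using assms by (auto simp: Hinf_iff)
  have "AE \<zeta> in torus N. cmod (\<phi> \<zeta> * \<psi> \<zeta>) \<le> B * C"
    using B C
  proof eventually_elim
    case (elim \<zeta>)
    thus ?case unfolding norm_mult
      by (intro mult_mono) (auto intro: order_trans[OF norm_ge_zero])
  qed
  with Hinf_mult_H2[OF assms(1) Hinf_H2[OF assms(2)]] show ?thesis
    by (auto simp: Hinf_iff)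
qed

lemma Hinf_power: "\<phi> \<in> Hinf N \<Longrightarrow> (\<lambda>\<zeta>. \<phi> \<zeta> ^ n) \<in> Hinf N"
  by (induction n) (simp_all add: one_Hinf Hinf_mult)

lemma mult_op_funpow: "(mult_op \<phi> ^^ n) f = (\<lambda>\<zeta>. \<phi> \<zeta> ^ n * f \<zeta>)"
  by (induction n) (auto simp: mult_op_def fun_eq_iff)

text \<open>The adjoint of multiplication by \<open>\<phi>\<close> on the Hardy space, that is, the Toeplitz operator with symbol \<open>cnj \<phi>\<close>.\<close>
definition mult_adjoint where
  "mult_adjoint N \<phi> y = H2_proj N (\<lambda>\<zeta>. cnj (\<phi> \<zeta>) * y \<zeta>)"

lemma mult_adjoint_H2: "\<phi> \<in> Hinf N \<Longrightarrow> y \<in> H2 N \<Longrightarrow> mult_adjoint N \<phi> y \<in> H2 N"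
  unfolding mult_adjoint_def by (intro H2_proj_in_H2 Hinf_mult_L2 H2_L2)

lemma mult_adjoint_inner:
  assumes "\<phi> \<in> Hinf N" "y \<in> H2 N" "g \<in> H2 N"
  shows "L2_inner N (mult_adjoint N \<phi> y) g = L2_inner N y (\<lambda>\<zeta>. \<phi> \<zeta> * g \<zeta>)"
  unfolding mult_adjoint_def L2_inner_mult_right
  by (intro H2_proj_inner Hinf_mult_L2(2) H2_L2 assms)

text \<open>
  Adjoints are only determined up to null sets, so identities such as the composition rule for
  adjoints are used in the form of equal norms.
\<close>
lemma L2_normsq_eqI:
  assumes "u \<in> H2 N" "v \<in> H2 N" "\<And>g. g \<in> H2 N \<Longrightarrow> L2_inner N u g = L2_inner N v g"
  shows "L2_normsq N u = L2_normsq N v"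
proof -
  have "L2_inner N u u = L2_inner N v u" using assms by simp
  also have "\<dots> = cnj (L2_inner N u v)" by (rule L2_inner_commute)
  also have "L2_inner N u v = L2_inner N v v" using assms by simp
  finally show ?thesis by (simp add: L2_inner_self)
qed

section \<open>A frame of orbits forces the norm condition\<close>

text \<open>
  By Markov's inequality the measure of \<open>{x. g x \<ge> r}\<close> is at most \<open>C / r ^ n\<close> for every \<open>n\<close>,
  so it vanishes for each \<open>r > 1\<close>.
\<close>
lemma AE_le_1_if_power_integrals_bounded:
  fixes g :: "'a \<Rightarrow> real"
  assumes int: "\<And>n. integrable M (\<lambda>x. g x ^ n)" and nonneg: "\<And>x. g x \<ge> 0"
    and bd: "\<And>n. (LINT x|M. g x ^ n) \<le> C" and fin: "finite_measure M"
  shows "AE x in M. g x \<le> 1"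
proof -
  interpret finite_measure M by fact
  have [measurable]: "g \<in> borel_measurable M" using int[of 1] by auto
  have "AE x in M. g x < 1 + inverse (real (Suc k))" for k
  proof -
    define r where "r = 1 + inverse (real (Suc k))"
    have r: "r > 1" by (simp add: r_def)
    let ?A = "{x \<in> space M. r \<le> g x}"
    have "measure M ?A \<le> C * (1 / r) ^ n" for n
    proof -
      have "measure M ?A \<le> measure M {x \<in> space M. r ^ n \<le> g x ^ n}"
        using r by (intro finite_measure_mono) (auto intro!: power_mono)
      also have "\<dots> \<le> (LINT x|M. g x ^ n) / r ^ n"
        using r nonneg by (intro integral_Markov_inequality_measure[where A = "{}"] int) auto
      also have "\<dots> \<le> C / r ^ n" using bd r by (intro divide_right_mono) auto
      finally show ?thesis by (simp add: power_divide)
    qed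
    moreover have "(\<lambda>n. C * (1 / r) ^ n) \<longlonglongrightarrow> C * 0"
      using r by (intro tendsto_mult LIMSEQ_power_zero tendsto_const) auto
    ultimately have "measure M ?A \<le> C * 0"
      by (intro LIMSEQ_le_const) auto
    hence "emeasure M ?A = 0" by (simp add: emeasure_eq_measure measure_le_0_iff)
    hence "AE x in M. \<not> r \<le> g x" by (subst AE_iff_measurable[OF _ refl]) auto
    thus ?thesis unfolding r_def by eventually_elim simp
  qed
  hence "AE x in M. \<forall>k. g x < 1 + inverse (real (Suc k))" by (simp add: AE_all_countable)
  thus ?thesis
  proof eventually_elim
    case (elim x)
    have "(\<lambda>k. 1 + inverse (real (Suc k))) \<longlonglongrightarrow> 1 + 0"
      by (intro tendsto_add tendsto_const LIMSEQ_inverse_real_of_nat)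
    hence "g x \<le> 1 + 0" using elim by (intro LIMSEQ_le_const) (auto intro: less_imp_le)
    thus ?case by simp
  qed
qed

lemma infsum_shift_le:
  fixes h :: "'i \<times> nat \<Rightarrow> real"
  assumes "h summable_on (I \<times> UNIV)" "\<And>x. h x \<ge> 0"
  shows "(\<Sum>\<^sub>\<infinity>(i, m)\<in>I \<times> UNIV. h (i, m + n)) \<le> infsum h (I \<times> UNIV)"
proof -
  let ?s = "\<lambda>(i :: 'i, m). (i, m + n)"
  have inj: "inj_on ?s (I \<times> UNIV)" by (auto simp: inj_on_def)
  have sub: "?s ` (I \<times> UNIV) \<subseteq> I \<times> UNIV" by auto
  have "(\<Sum>\<^sub>\<infinity>(i, m)\<in>I \<times> UNIV. h (i, m + n)) = infsum (h \<circ> ?s) (I \<times> UNIV)"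
    by (intro infsum_cong) auto
  also have "\<dots> = infsum h (?s ` (I \<times> UNIV))" by (rule infsum_reindex[OF inj, symmetric])
  also have "\<dots> \<le> infsum h (I \<times> UNIV)"
    using assms sub by (intro infsum_mono_neutral) (auto intro: summable_on_subset_banach)
  finally show ?thesis .
qed

text \<open>
  Let \<open>T\<close> be multiplication by \<open>\<phi>\<close>. Moving \<open>T ^ n\<close> to the other side of the inner product only
  shifts the index of the orbits, so the frame sum of the \<open>n\<close>-th adjoint power of \<open>y\<close> is a part
  of the frame sum of \<open>y\<close>. Hence the powers of the adjoint are bounded by \<open>B / A\<close> in
  squared norm. Taking \<open>y = \<phi> ^ n\<close> and testing against the constant function 1 turns this
  into a bound on \<open>\<phi> ^ n\<close> itself.
\<close>
lemma frame_of_orbits_power_bound: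
  assumes \<phi>: "\<phi> \<in> Hinf N" and A: "A > 0" and f: "\<And>i. i \<in> I \<Longrightarrow> f i \<in> H2 N"
    and frame: "frame_with_bounds (H2 N) (L2_inner N) A B (I \<times> UNIV) (\<lambda>(i, n). (mult_op \<phi> ^^ n) (f i))"
    and B: "B > 0"
  shows "L2_normsq N (\<lambda>\<zeta>. \<phi> \<zeta> ^ n) \<le> B / A"
proof -
  define \<psi> where "\<psi> = (\<lambda>\<zeta>. \<phi> \<zeta> ^ n)"
  have \<psi>: "\<psi> \<in> Hinf N" unfolding \<psi>_def by (rule Hinf_power[OF \<phi>])
  define z where "z = mult_adjoint N \<psi> \<psi>"
  have z: "z \<in> H2 N" unfolding z_def by (intro mult_adjoint_H2 \<psi> Hinf_H2)
  have orbit: "(mult_op \<phi> ^^ m) (f i) \<in> H2 N" if "i \<in> I" for i m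
    unfolding mult_op_funpow by (intro Hinf_mult_H2 Hinf_power \<phi> f that)
  let ?h = "\<lambda>y (i, m). (cmod (L2_inner N y ((mult_op \<phi> ^^ m) (f i))))\<^sup>2"
  have lower: "A * L2_normsq N z \<le> infsum (?h z) (I \<times> UNIV)"
    using frame z by (auto simp: frame_with_bounds_def L2_inner_self case_prod_unfold)
  have upper: "infsum (?h \<psi>) (I \<times> UNIV) \<le> B * L2_normsq N \<psi>" "?h \<psi> summable_on (I \<times> UNIV)"
    using frame Hinf_H2[OF \<psi>] by (auto simp: frame_with_bounds_def L2_inner_self case_prod_unfold)
  have shift: "L2_inner N z ((mult_op \<phi> ^^ m) (f i)) = L2_inner N \<psi> ((mult_op \<phi> ^^ (m + n)) (f i))" if "i \<in> I" for i m
    unfolding z_def using mult_adjoint_inner[OF \<psi> Hinf_H2[OF \<psi>] orbit[OF that]]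
    by (simp add: mult_op_funpow \<psi>_def power_add mult_ac)
  have "infsum (?h z) (I \<times> UNIV) = (\<Sum>\<^sub>\<infinity>(i, m)\<in>I \<times> UNIV. ?h \<psi> (i, m + n))"
    by (intro infsum_cong) (auto simp: shift)
  also have "\<dots> \<le> infsum (?h \<psi>) (I \<times> UNIV)"
    by (rule infsum_shift_le[OF upper(2)]) auto
  finally have zb: "A * L2_normsq N z \<le> B * L2_normsq N \<psi>" using lower upper by linarith
  have "L2_inner N z (\<lambda>_. 1) = L2_normsq N \<psi>"
    unfolding z_def using mult_adjoint_inner[OF \<psi> Hinf_H2[OF \<psi>] Hinf_H2[OF one_Hinf]]
    by (simp add: L2_inner_self)
  moreover have "L2_normsq N (\<lambda>_. 1) = 1" by (simp add: L2_normsq_def torus.prob_space)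
  ultimately have "(L2_normsq N \<psi>)\<^sup>2 \<le> L2_normsq N z"
    using L2_Cauchy_Schwarz[OF H2_L2[OF z] Hinf_L2[OF one_Hinf]] by simp
  hence "A * (L2_normsq N \<psi>)\<^sup>2 \<le> B * L2_normsq N \<psi>"
    using zb A by (meson mult_left_mono order_trans less_imp_le)
  hence "L2_normsq N \<psi> * (A * L2_normsq N \<psi>) \<le> L2_normsq N \<psi> * B"
    by (simp add: power2_eq_square mult_ac)
  hence "L2_normsq N \<psi> = 0 \<or> A * L2_normsq N \<psi> \<le> B"
    using L2_normsq_nonneg[of N \<psi>] by (cases "L2_normsq N \<psi> = 0") (simp_all add: mult_le_cancel_left_pos order.strict_iff_order)
  thus ?thesis using A B unfolding \<psi>_def by (auto simp: field_simps)
qed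

lemma frame_of_orbits_norm_le_1:
  assumes \<phi>: "\<phi> \<in> Hinf N" and frame: "admits_frame_of_orbits (H2 N) (L2_inner N) (mult_op \<phi>)"
  shows "Linf_norm N \<phi> \<le> 1"
proof -
  obtain I :: "nat set" and f A B where f: "\<And>i. i \<in> I \<Longrightarrow> f i \<in> H2 N" and AB: "A > 0" "B > 0"
    and fr: "frame_with_bounds (H2 N) (L2_inner N) A B (I \<times> UNIV) (\<lambda>(i, n). (mult_op \<phi> ^^ n) (f i))"
    using frame unfolding admits_frame_of_orbits_def is_frame_def by blast
  have "AE \<zeta> in torus N. (cmod (\<phi> \<zeta>))\<^sup>2 \<le> 1"
  proof (rule AE_le_1_if_power_integrals_bounded[where C = "B / A"])
    have eq: "((cmod (\<phi> \<zeta>))\<^sup>2) ^ n = (cmod (\<phi> \<zeta> ^ n))\<^sup>2" for \<zeta> n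
      by (simp add: norm_power power_mult[symmetric] mult.commute)
    show "integrable (torus N) (\<lambda>\<zeta>. ((cmod (\<phi> \<zeta>))\<^sup>2) ^ n)" for n
      unfolding eq using Hinf_L2[OF Hinf_power[OF \<phi>]] by (auto simp: L2_def)
    show "(LINT \<zeta>|torus N. ((cmod (\<phi> \<zeta>))\<^sup>2) ^ n) \<le> B / A" for n
      unfolding eq using frame_of_orbits_power_bound[OF \<phi> AB(1) f fr AB(2), of n]
      by (simp add: L2_normsq_def)
  qed (auto simp: torus.finite_measure_axioms)
  hence "AE \<zeta> in torus N. ereal (cmod (\<phi> \<zeta>)) \<le> 1"
    by eventually_elim (simp add: power_le_one_iff)
  moreover have "\<phi> \<in> borel_measurable (torus N)" by (rule L2_measurable[OF Hinf_L2[OF \<phi>]])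
  ultimately show ?thesis unfolding Linf_norm_def by (intro esssup_I) auto
qed

text \<open>
  Evaluation at the origin of the polydisc is multiplicative: at index 0 the Cauchy product has a
  single term. Equivalently, the constants are eigenvectors of the adjoint.
\<close>
lemma fourier_coeff_0_mult:
  assumes "\<phi> \<in> Hinf N" "g \<in> H2 N"
  shows "fourier_coeff N (\<lambda>\<zeta>. \<phi> \<zeta> * g \<zeta>) (\<lambda>_. 0) = fourier_coeff N \<phi> (\<lambda>_. 0) * fourier_coeff N g (\<lambda>_. 0)"
proof -
  have "PiE {..<N} (\<lambda>j. {0..0::int}) = {restrict (\<lambda>_. 0) {..<N}}"
    by (simp add: PiE_singleton)
  moreover have "fourier_coeff N \<phi> (\<lambda>j. 0 - restrict (\<lambda>_. 0) {..<N} j) = fourier_coeff N \<phi> (\<lambda>_. 0)"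
    by (rule fourier_coeff_cong) simp
  ultimately show ?thesis
    unfolding fourier_coeff_mult[OF assms] by (simp add: fourier_coeff_restrict)
qed

lemma fourier_coeff_0_power_mult:
  assumes "\<phi> \<in> Hinf N" "g \<in> H2 N"
  shows "fourier_coeff N (\<lambda>\<zeta>. \<phi> \<zeta> ^ n * g \<zeta>) (\<lambda>_. 0) = fourier_coeff N \<phi> (\<lambda>_. 0) ^ n * fourier_coeff N g (\<lambda>_. 0)"
proof (induction n)
  case (Suc n)
  have "(\<lambda>\<zeta>. \<phi> \<zeta> ^ n * g \<zeta>) \<in> H2 N" by (intro Hinf_mult_H2 Hinf_power assms)
  from fourier_coeff_0_mult[OF assms(1) this] Suc show ?case by (simp add: mult.assoc)
qed simp

text \<open>
  Pairing the constant function 1 with the orbit of \<open>f i\<close> gives a geometric sequence with ratio of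
  modulus \<open>cmod c\<close>, where \<open>c\<close> is the constant coefficient of \<open>\<phi>\<close>. If \<open>cmod c \<ge> 1\<close>, square
  summability makes it vanish, so the function 1 is orthogonal to all orbits, against the lower
  frame bound.
\<close>
lemma frame_of_orbits_constant_coeff:
  assumes \<phi>: "\<phi> \<in> Hinf N" and frame: "admits_frame_of_orbits (H2 N) (L2_inner N) (mult_op \<phi>)"
  shows "cmod (fourier_coeff N \<phi> (\<lambda>_. 0)) < 1"
proof (rule ccontr)
  assume neg: "\<not> ?thesis"
  define c where "c = fourier_coeff N \<phi> (\<lambda>_. 0)"
  have c: "cmod c \<ge> 1" using neg by (simp add: c_def)
  obtain I :: "nat set" and f A B where f: "\<And>i. i \<in> I \<Longrightarrow> f i \<in> H2 N" and AB: "A > 0" "B > 0"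
    and fr: "frame_with_bounds (H2 N) (L2_inner N) A B (I \<times> UNIV) (\<lambda>(i, n). (mult_op \<phi> ^^ n) (f i))"
    using frame unfolding admits_frame_of_orbits_def is_frame_def by blast
  let ?h = "\<lambda>(i, n). (cmod (L2_inner N (\<lambda>_. 1) ((mult_op \<phi> ^^ n) (f i))))\<^sup>2"
  have sum: "?h summable_on (I \<times> UNIV)"
    and lower: "A * L2_normsq N (\<lambda>_. 1) \<le> infsum ?h (I \<times> UNIV)"
    using fr Hinf_H2[OF one_Hinf, of N] by (auto simp: frame_with_bounds_def L2_inner_self case_prod_unfold)
  have h: "?h (i, n) = (cmod c)\<^sup>2 ^ n * (cmod (fourier_coeff N (f i) (\<lambda>_. 0)))\<^sup>2" if "i \<in> I" for i n
  proof -
    have "(\<lambda>_. 1) = monomial N (\<lambda>_. 0)" by (simp add: fun_eq_iff)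
    hence "L2_inner N (\<lambda>_. 1) ((mult_op \<phi> ^^ n) (f i)) = cnj (fourier_coeff N ((mult_op \<phi> ^^ n) (f i)) (\<lambda>_. 0))"
      unfolding fourier_coeff_eq_inner by (simp add: L2_inner_commute[of N "monomial N _"])
    also have "\<dots> = cnj (c ^ n * fourier_coeff N (f i) (\<lambda>_. 0))"
      unfolding mult_op_funpow c_def using \<phi> f[OF that] by (simp add: fourier_coeff_0_power_mult)
    finally show ?thesis
      by (simp add: norm_mult norm_power power_mult_distrib power_mult[symmetric] mult.commute)
  qed
  have zero: "fourier_coeff N (f i) (\<lambda>_. 0) = 0" if "i \<in> I" for i
  proof -
    let ?q = "(cmod (fourier_coeff N (f i) (\<lambda>_. 0)))\<^sup>2"
    have "(\<lambda>n. ?h (i, n)) summable_on UNIV"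
      using summable_on_SigmaD1[of "\<lambda>i n. ?h (i, n)" I "\<lambda>_. UNIV", OF _ that] sum by (simp add: case_prod_unfold)
    hence "summable (\<lambda>n. ?h (i, n))" by (rule summable_on_imp_summable)
    hence "(\<lambda>n. (cmod c)\<^sup>2 ^ n * ?q) \<longlonglongrightarrow> 0" unfolding h[OF that] by (rule summable_LIMSEQ_zero)
    moreover have "?q \<le> (cmod c)\<^sup>2 ^ n * ?q" for n
      using c mult_right_mono[of 1 "(cmod c)\<^sup>2 ^ n" ?q] by (simp add: one_le_power)
    ultimately have "?q \<le> 0" by (intro LIMSEQ_le_const) auto
    thus ?thesis by simp
  qed
  have "infsum ?h (I \<times> UNIV) = 0"
    by (rule infsum_0) (use h zero in auto)
  moreover have "L2_normsq N (\<lambda>_. 1) = 1" by (simp add: L2_normsq_def torus.prob_space)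
  ultimately show False using lower AB by simp
qed

section \<open>Strong convergence of the adjoint powers\<close>

text \<open>
  Once the perturbations are below \<open>r / 2 * (1 - cmod c)\<close>, the sequence approaches the disc of
  radius \<open>r / 2\<close> geometrically.
\<close>
lemma perturbed_contraction_tendsto_0:
  fixes x e :: "nat \<Rightarrow> complex"
  assumes rec: "\<And>n. x (Suc n) = c * x n + e n" and c: "cmod c < 1" and e: "e \<longlonglongrightarrow> 0"
  shows "x \<longlonglongrightarrow> 0"
proof (rule LIMSEQ_I)
  fix r :: real assume r: "r > 0"
  define \<epsilon> where "\<epsilon> = r / 2 * (1 - cmod c)"
  have "\<epsilon> > 0" using r c by (simp add: \<epsilon>_def)
  then obtain m where m: "\<And>n. n \<ge> m \<Longrightarrow> cmod (e n) < \<epsilon>"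
    using LIMSEQ_D[OF e] by auto
  have bound: "cmod (x (m + k)) \<le> cmod c ^ k * cmod (x m) + r / 2" for k
  proof (induction k)
    case 0
    show ?case using r by simp
  next
    case (Suc k)
    have "cmod (x (m + Suc k)) \<le> cmod c * cmod (x (m + k)) + cmod (e (m + k))"
      by (simp add: rec norm_mult[symmetric] norm_triangle_ineq)
    also have "\<dots> \<le> cmod c * (cmod c ^ k * cmod (x m) + r / 2) + \<epsilon>"
      using Suc m[of "m + k"] by (intro add_mono mult_left_mono) auto
    also have "\<dots> = cmod c ^ Suc k * cmod (x m) + r / 2"
      by (simp add: \<epsilon>_def field_simps)
    finally show ?case .
  qed
  have "(\<lambda>k. cmod c ^ k * cmod (x m)) \<longlonglongrightarrow> 0 * cmod (x m)"
    using c by (intro tendsto_mult LIMSEQ_power_zero tendsto_const) auto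
  hence "\<exists>k0. \<forall>k\<ge>k0. norm (cmod c ^ k * cmod (x m) - 0 * cmod (x m)) < r / 2"
    by (rule LIMSEQ_D) (use r in simp)
  then obtain k0 where k0: "\<forall>k\<ge>k0. norm (cmod c ^ k * cmod (x m) - 0 * cmod (x m)) < r / 2" by (rule exE)
  have "norm (x n - 0) < r" if "n \<ge> m + k0" for n
  proof -
    have "k0 \<le> n - m" using that by simp
    with k0 have "cmod c ^ (n - m) * cmod (x m) < r / 2" by fastforce
    with bound[of "n - m"] that show ?thesis by simp
  qed
  thus "\<exists>n0. \<forall>n\<ge>n0. norm (x n - 0) < r" by blast
qed

text \<open>
  The Cauchy product makes the coefficients of \<open>\<phi> ^ n\<close> satisfy a triangular recursion in the
  multi-index: the diagonal entry is the constant coefficient, of modulus less than 1, and the other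
  terms involve multi-indices of smaller total degree, which tend to 0 by induction.
\<close>
lemma fourier_coeff_power_tendsto_0:
  assumes \<phi>: "\<phi> \<in> Hinf N" and c: "cmod (fourier_coeff N \<phi> (\<lambda>_. 0)) < 1"
  shows "(\<lambda>n. fourier_coeff N (\<lambda>\<zeta>. \<phi> \<zeta> ^ n) \<gamma>) \<longlonglongrightarrow> 0"
proof (induction "\<Sum>j<N. nat (\<gamma> j)" arbitrary: \<gamma> rule: less_induct)
  case (less \<gamma>)
  let ?a = "\<lambda>\<delta> n. fourier_coeff N (\<lambda>\<zeta>. \<phi> \<zeta> ^ n) \<delta>"
  show ?case
  proof (cases "\<forall>j<N. 0 \<le> \<gamma> j")
    case False
    hence "?a \<gamma> n = 0" for n by (rule H2_coeff_eq_0[OF Hinf_H2[OF Hinf_power[OF \<phi>]]])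
    thus ?thesis by simp
  next
    case True
    let ?D = "PiE {..<N} (\<lambda>j. {0..\<gamma> j})" and ?\<gamma> = "restrict \<gamma> {..<N}"
    let ?e = "\<lambda>n. \<Sum>\<delta>\<in>?D - {?\<gamma>}. fourier_coeff N \<phi> (\<lambda>j. \<gamma> j - \<delta> j) * ?a \<delta> n"
    have fin: "finite ?D" by (intro finite_PiE) auto
    have mem: "?\<gamma> \<in> ?D" using True by auto
    show ?thesis
    proof (rule perturbed_contraction_tendsto_0[OF _ c])
      fix n
      have "?a \<gamma> (Suc n) = (\<Sum>\<delta>\<in>?D. fourier_coeff N \<phi> (\<lambda>j. \<gamma> j - \<delta> j) * ?a \<delta> n)"
        using fourier_coeff_mult[OF \<phi> Hinf_H2[OF Hinf_power[OF \<phi>]], of n \<gamma>] by simp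
      also have "\<dots> = fourier_coeff N \<phi> (\<lambda>j. \<gamma> j - ?\<gamma> j) * ?a ?\<gamma> n + ?e n"
        by (rule sum.remove[OF fin mem])
      also have "fourier_coeff N \<phi> (\<lambda>j. \<gamma> j - ?\<gamma> j) = fourier_coeff N \<phi> (\<lambda>_. 0)"
        by (rule fourier_coeff_cong) simp
      finally show "?a \<gamma> (Suc n) = fourier_coeff N \<phi> (\<lambda>_. 0) * ?a \<gamma> n + ?e n"
        unfolding fourier_coeff_restrict .
    next
      have "?a \<delta> \<longlonglongrightarrow> 0" if \<delta>: "\<delta> \<in> ?D - {?\<gamma>}" for \<delta>
      proof (rule less)
        have "\<exists>j<N. \<delta> j \<noteq> \<gamma> j"
        proof (rule ccontr)
          assume "\<not> ?thesis"
          hence "\<delta> = ?\<gamma>" using \<delta> by (intro ext) (auto simp: PiE_iff extensional_def)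
          thus False using \<delta> by simp
        qed
        then obtain j where j: "j < N" "\<delta> j \<noteq> \<gamma> j" by blast
        have le: "0 \<le> \<delta> i \<and> \<delta> i \<le> \<gamma> i" if "i < N" for i
          using \<delta> that by (auto simp: PiE_iff)
        show "(\<Sum>j<N. nat (\<delta> j)) < (\<Sum>j<N. nat (\<gamma> j))"
        proof (rule sum_strict_mono_ex1)
          show "\<exists>i\<in>{..<N}. nat (\<delta> i) < nat (\<gamma> i)"
            using j le[of j] by (intro bexI[of _ j]) auto
        qed (use le in \<open>auto intro: nat_mono\<close>)
      qed
      hence "?e \<longlonglongrightarrow> (\<Sum>\<delta>\<in>?D - {?\<gamma>}. fourier_coeff N \<phi> (\<lambda>j. \<gamma> j - \<delta> j) * 0)"
        by (intro tendsto_sum tendsto_mult tendsto_const)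
      thus "?e \<longlonglongrightarrow> 0" by simp
    qed
  qed
qed

lemma fourier_coeff_bound:
  assumes "f \<in> L2 N"
  shows "cmod (fourier_coeff N f \<alpha>) \<le> sqrt (L2_normsq N f)"
  using Bessel_finite[OF assms, of "{restrict \<alpha> {..<N}}"]
  by (intro real_le_rsqrt) (simp add: restrict_in_multi_indices fourier_coeff_restrict)

text \<open>
  Against a single monomial only finitely many coefficients of \<open>\<phi> ^ n\<close> enter, and all of them
  tend to 0. The general \<open>y\<close> is approximated by a partial Fourier sum, using that the functions
  \<open>\<phi> ^ n * g n\<close> stay bounded in norm. Allowing \<open>g\<close> to vary with \<open>n\<close> is essential: the lemma is
  applied to the adjoint powers of \<open>y\<close> to obtain strong convergence.
\<close>
lemma powers_weakly_tendsto_0: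
  assumes \<phi>: "\<phi> \<in> Hinf N" and c: "cmod (fourier_coeff N \<phi> (\<lambda>_. 0)) < 1"
    and le1: "AE \<zeta> in torus N. cmod (\<phi> \<zeta>) \<le> 1"
    and y: "y \<in> H2 N" and g: "\<And>n. g n \<in> H2 N" and bd: "\<And>n. L2_normsq N (g n) \<le> C"
  shows "(\<lambda>n. L2_inner N y (\<lambda>\<zeta>. \<phi> \<zeta> ^ n * g n \<zeta>)) \<longlonglongrightarrow> 0"
proof -
  let ?h = "\<lambda>n \<zeta>. \<phi> \<zeta> ^ n * g n \<zeta>"
  have h: "?h n \<in> H2 N" for n by (intro Hinf_mult_H2 Hinf_power \<phi> g)
  have h_bd: "L2_normsq N (?h n) \<le> C" for n
  proof -
    have "L2_normsq N (?h n) \<le> L2_normsq N (g n)"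
      unfolding L2_normsq_def
    proof (rule integral_mono_AE)
      show "AE \<zeta> in torus N. (cmod (?h n \<zeta>))\<^sup>2 \<le> (cmod (g n \<zeta>))\<^sup>2"
        using le1
      proof eventually_elim
        case (elim \<zeta>)
        have "cmod (?h n \<zeta>) \<le> 1 * cmod (g n \<zeta>)"
          unfolding norm_mult norm_power using elim by (intro mult_right_mono power_le_one) auto
        thus ?case by (intro power_mono) auto
      qed
    qed (use H2_L2[OF h[of n]] H2_L2[OF g[of n]] in \<open>auto simp: L2_def\<close>)
    thus ?thesis using bd by (rule order_trans)
  qed
  have C: "C \<ge> 0" using order_trans[OF L2_normsq_nonneg bd] .
  have coeff: "(\<lambda>n. fourier_coeff N (?h n) \<alpha>) \<longlonglongrightarrow> 0" for \<alpha>
  proof -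
    have "(\<lambda>n. fourier_coeff N (\<lambda>\<zeta>. \<phi> \<zeta> ^ n) \<gamma> * fourier_coeff N (g n) \<delta>) \<longlonglongrightarrow> 0" for \<gamma> \<delta>
    proof (rule Lim_null_comparison)
      show "\<forall>\<^sub>F n in sequentially. norm (fourier_coeff N (\<lambda>\<zeta>. \<phi> \<zeta> ^ n) \<gamma> * fourier_coeff N (g n) \<delta>)
          \<le> cmod (fourier_coeff N (\<lambda>\<zeta>. \<phi> \<zeta> ^ n) \<gamma>) * sqrt C"
      proof (intro always_eventually allI)
        fix n
        have "cmod (fourier_coeff N (g n) \<delta>) \<le> sqrt C"
          by (rule order_trans[OF fourier_coeff_bound[OF H2_L2[OF g[of n]]] real_sqrt_le_mono[OF bd]])
        thus "norm (fourier_coeff N (\<lambda>\<zeta>. \<phi> \<zeta> ^ n) \<gamma> * fourier_coeff N (g n) \<delta>)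
            \<le> cmod (fourier_coeff N (\<lambda>\<zeta>. \<phi> \<zeta> ^ n) \<gamma>) * sqrt C"
          unfolding norm_mult by (intro mult_left_mono) auto
      qed
      show "(\<lambda>n. cmod (fourier_coeff N (\<lambda>\<zeta>. \<phi> \<zeta> ^ n) \<gamma>) * sqrt C) \<longlonglongrightarrow> 0"
        using tendsto_mult[OF tendsto_norm_zero[OF fourier_coeff_power_tendsto_0[OF \<phi> c]] tendsto_const, of \<gamma> "sqrt C"]
        by simp
    qed
    hence "(\<lambda>n. \<Sum>\<delta>\<in>PiE {..<N} (\<lambda>j. {0..\<alpha> j}). fourier_coeff N (\<lambda>\<zeta>. \<phi> \<zeta> ^ n) (\<lambda>j. \<alpha> j - \<delta> j) * fourier_coeff N (g n) \<delta>)
        \<longlonglongrightarrow> (\<Sum>\<delta>\<in>PiE {..<N} (\<lambda>j. {0..\<alpha> j}). 0)"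
      by (intro tendsto_sum)
    thus ?thesis by (simp add: fourier_coeff_mult[OF Hinf_power[OF \<phi>] g])
  qed
  show ?thesis
  proof (rule LIMSEQ_I)
    fix r :: real assume r: "r > 0"
    \<comment> \<open>Cauchy-Schwarz leaves the error \<open>\<epsilon> * C\<close>; the summand 1 covers the case \<open>C = 0\<close>\<close>
    define \<epsilon> where "\<epsilon> = (r / 2)\<^sup>2 / (C + 1)"
    have \<epsilon>: "\<epsilon> > 0" using r C by (simp add: \<epsilon>_def)
    obtain F where F: "finite F" "F \<subseteq> multi_indices N"
      and dist: "dist (\<Sum>\<alpha>\<in>F. (cmod (fourier_coeff N y \<alpha>))\<^sup>2) (L2_normsq N y) < \<epsilon>"
    proof -
      obtain F where "finite F" "F \<subseteq> multi_indices N" and *: "\<forall>Y. finite Y \<and> F \<subseteq> Y \<and> Y \<subseteq> multi_indices N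
          \<longrightarrow> dist (\<Sum>\<alpha>\<in>Y. (cmod (fourier_coeff N y \<alpha>))\<^sup>2) (L2_normsq N y) < \<epsilon>"
        using Parseval[OF H2_L2[OF y], unfolded has_sum_def, THEN tendstoD, OF \<epsilon>]
        unfolding eventually_finite_subsets_at_top by (elim exE conjE)
      with *[rule_format, of F] show ?thesis by (intro that[of F]) auto
    qed
    let ?s = "\<lambda>\<zeta>. \<Sum>\<alpha>\<in>F. fourier_coeff N y \<alpha> * monomial N \<alpha> \<zeta>"
    have s: "?s \<in> L2 N" by (intro L2_sum L2_cmult L2_monomial)
    have d: "(\<lambda>\<zeta>. y \<zeta> - ?s \<zeta>) \<in> L2 N" by (intro L2_diff s H2_L2 y)
    have dn: "L2_normsq N (\<lambda>\<zeta>. y \<zeta> - ?s \<zeta>) \<le> \<epsilon>"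
      using dist unfolding L2_normsq_diff_trig_sum[OF H2_L2[OF y] F] dist_real_def by linarith
    have rest: "cmod (L2_inner N (\<lambda>\<zeta>. y \<zeta> - ?s \<zeta>) (?h n)) \<le> r / 2" for n
    proof (rule power2_le_imp_le)
      have "(cmod (L2_inner N (\<lambda>\<zeta>. y \<zeta> - ?s \<zeta>) (?h n)))\<^sup>2 \<le> \<epsilon> * C"
        using L2_Cauchy_Schwarz[OF d H2_L2[OF h[of n]]]
          mult_mono[OF dn h_bd[of n] less_imp_le[OF \<epsilon>] L2_normsq_nonneg] by linarith
      also have "\<dots> \<le> \<epsilon> * (C + 1)" using \<epsilon> by (intro mult_left_mono) auto
      also have "\<dots> = (r / 2)\<^sup>2" using C by (simp add: \<epsilon>_def)
      finally show "(cmod (L2_inner N (\<lambda>\<zeta>. y \<zeta> - ?s \<zeta>) (?h n)))\<^sup>2 \<le> (r / 2)\<^sup>2" .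
    qed (use r in simp)
    have inner_s: "L2_inner N ?s (?h n) = (\<Sum>\<alpha>\<in>F. fourier_coeff N y \<alpha> * cnj (fourier_coeff N (?h n) \<alpha>))" for n
      using H2_L2[OF h[of n]] by (subst L2_inner_sum_left)
        (auto simp: L2_cmult L2_monomial L2_inner_cmult_left fourier_coeff_eq_inner L2_inner_commute[of N "monomial N _"])
    have "(\<lambda>n. L2_inner N ?s (?h n)) \<longlonglongrightarrow> (\<Sum>\<alpha>\<in>F. fourier_coeff N y \<alpha> * cnj 0)"
      unfolding inner_s by (intro tendsto_sum tendsto_mult tendsto_const tendsto_cnj coeff)
    hence "(\<lambda>n. L2_inner N ?s (?h n)) \<longlonglongrightarrow> 0" by simp
    hence "\<exists>n0. \<forall>n\<ge>n0. norm (L2_inner N ?s (?h n) - 0) < r / 2"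
      by (rule LIMSEQ_D) (use r in simp)
    then obtain n0 where n0: "\<forall>n\<ge>n0. norm (L2_inner N ?s (?h n) - 0) < r / 2" by (rule exE)
    have "norm (L2_inner N y (?h n) - 0) < r" if "n \<ge> n0" for n
    proof -
      have "L2_inner N y (?h n) = L2_inner N (\<lambda>\<zeta>. y \<zeta> - ?s \<zeta>) (?h n) + L2_inner N ?s (?h n)"
        by (subst L2_inner_diff_left[OF H2_L2[OF y] s H2_L2[OF h]]) simp
      hence "norm (L2_inner N y (?h n)) \<le> cmod (L2_inner N (\<lambda>\<zeta>. y \<zeta> - ?s \<zeta>) (?h n)) + cmod (L2_inner N ?s (?h n))"
        by (simp only: norm_triangle_ineq)
      thus ?thesis using rest[of n] n0[rule_format, OF that] by simp
    qed
    thus "\<exists>n0. \<forall>n\<ge>n0. norm (L2_inner N y (?h n) - 0) < r" by blast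
  qed
qed

lemma H2_proj_normsq_le:
  assumes "f \<in> L2 N"
  shows "L2_normsq N (H2_proj N f) \<le> L2_normsq N f"
proof (rule has_sum_mono_neutral[OF H2_proj_normsq[OF assms] Parseval[OF assms]])
qed (use nonneg_multi_indices_subset[of N] in auto)

lemma mult_adjoint_normsq_le:
  assumes \<phi>: "\<phi> \<in> Hinf N" and le1: "AE \<zeta> in torus N. cmod (\<phi> \<zeta>) \<le> 1" and y: "y \<in> H2 N"
  shows "L2_normsq N (mult_adjoint N \<phi> y) \<le> L2_normsq N y"
proof -
  have h: "(\<lambda>\<zeta>. cnj (\<phi> \<zeta>) * y \<zeta>) \<in> L2 N" by (intro Hinf_mult_L2(2) \<phi> H2_L2 y)
  have "L2_normsq N (mult_adjoint N \<phi> y) \<le> L2_normsq N (\<lambda>\<zeta>. cnj (\<phi> \<zeta>) * y \<zeta>)"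
    unfolding mult_adjoint_def by (rule H2_proj_normsq_le[OF h])
  also have "\<dots> \<le> L2_normsq N y"
    unfolding L2_normsq_def
  proof (rule integral_mono_AE)
    show "AE \<zeta> in torus N. (cmod (cnj (\<phi> \<zeta>) * y \<zeta>))\<^sup>2 \<le> (cmod (y \<zeta>))\<^sup>2"
      using le1
    proof eventually_elim
      case (elim \<zeta>)
      have "cmod (cnj (\<phi> \<zeta>) * y \<zeta>) \<le> 1 * cmod (y \<zeta>)"
        unfolding norm_mult complex_mod_cnj using elim by (intro mult_right_mono) auto
      thus ?case by (intro power_mono) auto
    qed
  qed (use h H2_L2[OF y] in \<open>auto simp: L2_def\<close>)
  finally show ?thesis .
qed

text \<open>
  With \<open>z n\<close> the \<open>n\<close>-th adjoint power of \<open>y\<close>, the squared norm of \<open>z n\<close> is the inner product of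
  \<open>y\<close> with \<open>\<phi> ^ n * z n\<close>, so weak convergence of these products is enough.
\<close>
lemma adjoint_powers_tendsto_0:
  assumes \<phi>: "\<phi> \<in> Hinf N" and c: "cmod (fourier_coeff N \<phi> (\<lambda>_. 0)) < 1"
    and le1: "AE \<zeta> in torus N. cmod (\<phi> \<zeta>) \<le> 1" and y: "y \<in> H2 N"
  shows "(\<lambda>n. L2_normsq N (mult_adjoint N (\<lambda>\<zeta>. \<phi> \<zeta> ^ n) y)) \<longlonglongrightarrow> 0"
proof -
  let ?z = "\<lambda>n. mult_adjoint N (\<lambda>\<zeta>. \<phi> \<zeta> ^ n) y"
  have z: "?z n \<in> H2 N" for n by (intro mult_adjoint_H2 Hinf_power \<phi> y)
  have "AE \<zeta> in torus N. cmod (\<phi> \<zeta> ^ n) \<le> 1" for n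
    using le1 by eventually_elim (simp add: norm_power power_le_one)
  hence "L2_normsq N (?z n) \<le> L2_normsq N y" for n
    by (intro mult_adjoint_normsq_le Hinf_power \<phi> y)
  from powers_weakly_tendsto_0[OF \<phi> c le1 y z this]
  have "(\<lambda>n. L2_inner N (?z n) (?z n)) \<longlonglongrightarrow> 0"
    by (simp add: mult_adjoint_inner[OF Hinf_power[OF \<phi>] y z])
  hence "(\<lambda>n. Re (L2_inner N (?z n) (?z n))) \<longlonglongrightarrow> Re 0" by (rule tendsto_Re)
  thus ?thesis by (simp add: L2_inner_self)
qed

section \<open>A Parseval frame of orbits\<close>

text \<open>
  With \<open>T\<close> multiplication by \<open>\<phi>\<close>, generators with \<open>\<Sum>k. \<bar>\<langle>y, F k\<rangle>\<bar>\<^sup>2 = \<parallel>y\<parallel>\<^sup>2 - \<parallel>T\<^sup>* y\<parallel>\<^sup>2\<close> are needed. The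
  usual choice applies the square root of the defect operator \<open>1 - T T\<^sup>*\<close> to an orthonormal basis. Here the
  right-hand side splits into two parts that yield explicit generators,
  \<open>\<parallel>w y\<parallel>\<^sup>2 + \<parallel>(1 - P) (cnj \<phi> y)\<parallel>\<^sup>2\<close>, where \<open>P\<close> projects onto the Hardy space and the weight is
  \<open>w = sqrt (1 - \<bar>\<phi>\<bar>\<^sup>2)\<close>. By Parseval the first is a sum over all
  characters and the second one over the characters outside the Hardy space. The Boolean
  tag in the index separates the two parts.
\<close>
definition defect_weight :: "((nat \<Rightarrow> complex) \<Rightarrow> complex) \<Rightarrow> (nat \<Rightarrow> complex) \<Rightarrow> complex" where
  "defect_weight \<phi> \<zeta> = of_real (sqrt (1 - (cmod (\<phi> \<zeta>))\<^sup>2))"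

definition defect_index :: "nat \<Rightarrow> ((nat \<Rightarrow> int) \<times> bool) set" where
  "defect_index N = multi_indices N \<times> {True} \<union> (multi_indices N - nonneg_multi_indices N) \<times> {False}"

definition defect_family where
  "defect_family N \<phi> k = H2_proj N (\<lambda>\<zeta>. (if snd k then defect_weight \<phi> \<zeta> else \<phi> \<zeta>) * monomial N (fst k) \<zeta>)"

lemma countable_defect_index: "countable (defect_index N)"
  unfolding defect_index_def using countable_multi_indices[of N] by (auto intro: countable_Diff)

context
  fixes N :: nat and \<phi> :: "(nat \<Rightarrow> complex) \<Rightarrow> complex"
  assumes \<phi>: "\<phi> \<in> Hinf N" and le1: "AE \<zeta> in torus N. cmod (\<phi> \<zeta>) \<le> 1"
begin

lemma defect_weight_measurable: "defect_weight \<phi> \<in> borel_measurable (torus N)"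
  unfolding defect_weight_def using L2_measurable[OF Hinf_L2[OF \<phi>]] by measurable

lemma defect_weight_mult_L2: "g \<in> L2 N \<Longrightarrow> (\<lambda>\<zeta>. defect_weight \<phi> \<zeta> * g \<zeta>) \<in> L2 N"
proof (rule L2_mult_AE_bounded[where B = 1, OF _ defect_weight_measurable])
  show "AE \<zeta> in torus N. cmod (defect_weight \<phi> \<zeta>) \<le> 1"
    using le1 by eventually_elim (simp add: defect_weight_def power_le_one)
qed

lemma defect_family_H2: "defect_family N \<phi> k \<in> H2 N"
  unfolding defect_family_def
  by (cases "snd k") (auto intro!: H2_proj_in_H2 defect_weight_mult_L2 Hinf_mult_L2(1) L2_monomial \<phi>)

lemma defect_weight_normsq:
  assumes y: "y \<in> L2 N"
  shows "L2_normsq N (\<lambda>\<zeta>. defect_weight \<phi> \<zeta> * y \<zeta>) = L2_normsq N y - L2_normsq N (\<lambda>\<zeta>. cnj (\<phi> \<zeta>) * y \<zeta>)"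
proof -
  have h: "(\<lambda>\<zeta>. cnj (\<phi> \<zeta>) * y \<zeta>) \<in> L2 N" by (rule Hinf_mult_L2(2)[OF \<phi> y])
  have "L2_normsq N (\<lambda>\<zeta>. defect_weight \<phi> \<zeta> * y \<zeta>) = (LINT \<zeta>|torus N. (cmod (y \<zeta>))\<^sup>2 - (cmod (cnj (\<phi> \<zeta>) * y \<zeta>))\<^sup>2)"
    unfolding L2_normsq_def
  proof (rule integral_cong_AE)
    show "AE \<zeta> in torus N. (cmod (defect_weight \<phi> \<zeta> * y \<zeta>))\<^sup>2 = (cmod (y \<zeta>))\<^sup>2 - (cmod (cnj (\<phi> \<zeta>) * y \<zeta>))\<^sup>2"
      using le1
    proof eventually_elim
      case (elim \<zeta>)
      hence "(cmod (\<phi> \<zeta>))\<^sup>2 \<le> 1" by (simp add: power_le_one)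
      thus ?case by (simp add: defect_weight_def norm_mult power_mult_distrib algebra_simps)
    qed
  qed (use L2_measurable[OF defect_weight_mult_L2[OF y]] L2_measurable[OF y] L2_measurable[OF h] in measurable)
  also have "\<dots> = L2_normsq N y - L2_normsq N (\<lambda>\<zeta>. cnj (\<phi> \<zeta>) * y \<zeta>)"
    unfolding L2_normsq_def using y h by (intro Bochner_Integration.integral_diff) (auto simp: L2_def)
  finally show ?thesis .
qed

lemma defect_family_has_sum:
  assumes y: "y \<in> H2 N"
  shows "((\<lambda>k. (cmod (L2_inner N y (defect_family N \<phi> k)))\<^sup>2) has_sum
    (L2_normsq N y - L2_normsq N (mult_adjoint N \<phi> y))) (defect_index N)"
proof -
  let ?J = "multi_indices N" and ?P = "nonneg_multi_indices N"
  let ?w = "\<lambda>\<zeta>. defect_weight \<phi> \<zeta> * y \<zeta>" and ?h = "\<lambda>\<zeta>. cnj (\<phi> \<zeta>) * y \<zeta>"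
  let ?t = "\<lambda>k. (cmod (L2_inner N y (defect_family N \<phi> k)))\<^sup>2"
  have w: "?w \<in> L2 N" by (rule defect_weight_mult_L2[OF H2_L2[OF y]])
  have h: "?h \<in> L2 N" by (rule Hinf_mult_L2(2)[OF \<phi> H2_L2[OF y]])
  have proj: "L2_inner N y (H2_proj N g) = L2_inner N y g" if "g \<in> L2 N" for g
    by (subst (1 2) L2_inner_commute) (simp add: H2_proj_inner[OF that y])
  have T: "?t (\<alpha>, True) = (cmod (fourier_coeff N ?w \<alpha>))\<^sup>2" for \<alpha>
  proof -
    have "L2_inner N y (defect_family N \<phi> (\<alpha>, True)) = L2_inner N y (\<lambda>\<zeta>. defect_weight \<phi> \<zeta> * monomial N \<alpha> \<zeta>)"
      unfolding defect_family_def by (simp add: proj defect_weight_mult_L2 L2_monomial)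
    also have "\<dots> = fourier_coeff N ?w \<alpha>"
      unfolding L2_inner_mult_right fourier_coeff_eq_inner by (simp add: defect_weight_def)
    finally show ?thesis by simp
  qed
  have F: "?t (\<alpha>, False) = (cmod (fourier_coeff N ?h \<alpha>))\<^sup>2" for \<alpha>
  proof -
    have "L2_inner N y (defect_family N \<phi> (\<alpha>, False)) = L2_inner N y (\<lambda>\<zeta>. \<phi> \<zeta> * monomial N \<alpha> \<zeta>)"
      unfolding defect_family_def by (simp add: proj Hinf_mult_L2(1)[OF \<phi>] L2_monomial)
    also have "\<dots> = fourier_coeff N ?h \<alpha>"
      unfolding L2_inner_mult_right fourier_coeff_eq_inner ..
    finally show ?thesis by simp
  qed
  have "(?t has_sum L2_normsq N ?w) ((\<lambda>\<alpha>. (\<alpha>, True)) ` ?J)"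
    using Parseval[OF w] by (subst has_sum_reindex) (auto simp: inj_on_def o_def T)
  moreover have "(?t has_sum (L2_normsq N ?h - L2_normsq N (mult_adjoint N \<phi> y))) ((\<lambda>\<alpha>. (\<alpha>, False)) ` (?J - ?P))"
    using has_sum_Diff[OF Parseval[OF h] H2_proj_normsq[OF h] nonneg_multi_indices_subset]
    by (subst has_sum_reindex) (auto simp: inj_on_def o_def F mult_adjoint_def)
  ultimately have "(?t has_sum (L2_normsq N ?w + (L2_normsq N ?h - L2_normsq N (mult_adjoint N \<phi> y))))
      ((\<lambda>\<alpha>. (\<alpha>, True)) ` ?J \<union> (\<lambda>\<alpha>. (\<alpha>, False)) ` (?J - ?P))"
    by (rule has_sum_Un_disjoint) auto
  moreover have "(\<lambda>\<alpha>. (\<alpha>, True)) ` ?J \<union> (\<lambda>\<alpha>. (\<alpha>, False)) ` (?J - ?P) = defect_index N"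
    by (auto simp: defect_index_def)
  ultimately show ?thesis by (simp add: defect_weight_normsq[OF H2_L2[OF y]])
qed

text \<open>
  Summing the defect identity along the orbit telescopes to the squared norm of \<open>y\<close> minus the
  limit of the squared norms of its adjoint powers, which is 0.
\<close>
lemma defect_orbits_has_sum:
  assumes c: "cmod (fourier_coeff N \<phi> (\<lambda>_. 0)) < 1" and y: "y \<in> H2 N"
  shows "((\<lambda>(k, n). (cmod (L2_inner N y ((mult_op \<phi> ^^ n) (defect_family N \<phi> k))))\<^sup>2) has_sum L2_normsq N y)
    (defect_index N \<times> UNIV)"
proof -
  let ?z = "\<lambda>n. mult_adjoint N (\<lambda>\<zeta>. \<phi> \<zeta> ^ n) y"
  let ?a = "\<lambda>n. L2_normsq N (?z n)"
  let ?t = "\<lambda>(n, k). (cmod (L2_inner N y ((mult_op \<phi> ^^ n) (defect_family N \<phi> k))))\<^sup>2"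
  have z: "?z n \<in> H2 N" for n by (intro mult_adjoint_H2 Hinf_power \<phi> y)
  have z_inner: "L2_inner N (?z n) g = L2_inner N y (\<lambda>\<zeta>. \<phi> \<zeta> ^ n * g \<zeta>)" if "g \<in> H2 N" for n g
    by (rule mult_adjoint_inner[OF Hinf_power[OF \<phi>] y that])
  have step: "L2_normsq N (mult_adjoint N \<phi> (?z n)) = ?a (Suc n)" for n
  proof (rule L2_normsq_eqI)
    fix g assume g: "g \<in> H2 N"
    have "L2_inner N (mult_adjoint N \<phi> (?z n)) g = L2_inner N (?z n) (\<lambda>\<zeta>. \<phi> \<zeta> * g \<zeta>)"
      by (rule mult_adjoint_inner[OF \<phi> z g])
    also have "\<dots> = L2_inner N y (\<lambda>\<zeta>. \<phi> \<zeta> ^ n * (\<phi> \<zeta> * g \<zeta>))"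
      by (rule z_inner[OF Hinf_mult_H2[OF \<phi> g]])
    also have "\<dots> = L2_inner N (?z (Suc n)) g"
      unfolding z_inner[OF g] by (simp add: mult_ac)
    finally show "L2_inner N (mult_adjoint N \<phi> (?z n)) g = L2_inner N (?z (Suc n)) g" .
  qed (intro mult_adjoint_H2 \<phi> z, rule z)
  have a0: "?a 0 = L2_normsq N y"
    by (rule L2_normsq_eqI[OF z y]) (simp add: z_inner[of _ 0, simplified])
  have inner: "((\<lambda>k. ?t (n, k)) has_sum (?a n - ?a (Suc n))) (defect_index N)" for n
    using defect_family_has_sum[OF z[of n]]
    unfolding step z_inner[OF defect_family_H2] mult_op_funpow by simp
  have nonneg: "0 \<le> ?a n - ?a (Suc n)" for n
    by (rule has_sum_nonneg[OF inner]) auto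
  have "(\<lambda>n. ?a n - ?a (Suc n)) sums (?a 0 - 0)"
    by (rule telescope_sums'[OF adjoint_powers_tendsto_0[OF \<phi> c le1 y]])
  hence outer: "((\<lambda>n. ?a n - ?a (Suc n)) has_sum L2_normsq N y) UNIV"
    unfolding a0 diff_zero by (rule sums_nonneg_imp_has_sum) (rule nonneg)
  have "(?t has_sum L2_normsq N y) (UNIV \<times> defect_index N)"
  proof (rule has_sum_SigmaI[OF inner outer])
    show "?t summable_on UNIV \<times> defect_index N"
      using inner has_sum_imp_summable[OF outer] by (rule summable_on_SigmaI) auto
  qed
  from this[unfolded has_sum_swap[of ?t]] show ?thesis by (simp add: case_prod_unfold)
qed

text \<open>
  Only the index set remains to be moved into the natural numbers.
\<close>
lemma Parseval_frame_of_defect_orbits: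
  assumes c: "cmod (fourier_coeff N \<phi> (\<lambda>_. 0)) < 1"
  shows "admits_parseval_frame_of_orbits (H2 N) (L2_inner N) (mult_op \<phi>)"
proof -
  let ?K = "defect_index N"
  define I where "I = to_nat_on ?K ` ?K"
  define f where "f i = defect_family N \<phi> (from_nat_into ?K i)" for i
  have f: "f i \<in> H2 N" for i unfolding f_def by (rule defect_family_H2)
  have "frame_with_bounds (H2 N) (L2_inner N) 1 1 (I \<times> UNIV) (\<lambda>(i, n). (mult_op \<phi> ^^ n) (f i))"
    unfolding frame_with_bounds_def
  proof (intro conjI ballI)
    show "countable (I \<times> (UNIV :: nat set))" by simp
    show "(case p of (i, n) \<Rightarrow> (mult_op \<phi> ^^ n) (f i)) \<in> H2 N" for p
      by (auto simp: mult_op_funpow split: prod.split intro!: Hinf_mult_H2 Hinf_power \<phi> f)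
    fix y assume y: "y \<in> H2 N"
    let ?g = "\<lambda>p. (cmod (L2_inner N y (case p of (i, n) \<Rightarrow> (mult_op \<phi> ^^ n) (f i))))\<^sup>2"
    let ?r = "\<lambda>(k, n :: nat). (to_nat_on ?K k, n)"
    have inj: "inj_on ?r (?K \<times> UNIV)"
      using inj_on_to_nat_on[OF countable_defect_index[of N]] by (auto simp: inj_on_def)
    have img: "?r ` (?K \<times> UNIV) = I \<times> UNIV" by (auto simp: I_def image_iff)
    have "(?g has_sum L2_normsq N y) (?r ` (?K \<times> UNIV))"
      unfolding has_sum_reindex[OF inj]
      using defect_orbits_has_sum[OF c y]
    proof (rule has_sum_cong[THEN iffD1, rotated])
      fix p assume "p \<in> ?K \<times> (UNIV :: nat set)"
      thus "(case p of (k, n) \<Rightarrow> (cmod (L2_inner N y ((mult_op \<phi> ^^ n) (defect_family N \<phi> k))))\<^sup>2) = (?g \<circ> ?r) p"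
        by (auto simp: f_def countable_defect_index)
    qed
    hence S: "(?g has_sum L2_normsq N y) (I \<times> UNIV)" by (simp only: img)
    show "?g summable_on (I \<times> UNIV)" by (rule has_sum_imp_summable[OF S])
    show "1 * Re (L2_inner N y y) \<le> infsum ?g (I \<times> UNIV)" "infsum ?g (I \<times> UNIV) \<le> 1 * Re (L2_inner N y y)"
      using infsumI[OF S] by (simp_all add: L2_inner_self)
  qed
  thus ?thesis
    unfolding admits_parseval_frame_of_orbits_def is_parseval_frame_def using f by blast
qed

end

theorem theorem2p3:
  fixes N :: nat and \<phi> :: "(nat \<Rightarrow> complex) \<Rightarrow> complex"
  assumes "N \<ge> 1" and "\<phi> \<in> Hinf N"
  shows "(admits_parseval_frame_of_orbits (H2 N) (L2_inner N) (mult_op \<phi>) \<longleftrightarrow>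
          admits_frame_of_orbits (H2 N) (L2_inner N) (mult_op \<phi>)) \<and>
         (admits_frame_of_orbits (H2 N) (L2_inner N) (mult_op \<phi>) \<longleftrightarrow>
          (Linf_norm N \<phi> \<le> 1 \<and> cmod (fourier_coeff N \<phi> (\<lambda>_. 0)) < 1))"
proof -
  let ?i = "admits_parseval_frame_of_orbits (H2 N) (L2_inner N) (mult_op \<phi>)"
  let ?ii = "admits_frame_of_orbits (H2 N) (L2_inner N) (mult_op \<phi>)"
  let ?iii = "Linf_norm N \<phi> \<le> 1 \<and> cmod (fourier_coeff N \<phi> (\<lambda>_. 0)) < 1"
  have "?i \<Longrightarrow> ?ii"
    unfolding admits_parseval_frame_of_orbits_def admits_frame_of_orbits_def is_parseval_frame_def is_frame_def
    using zero_less_one by blast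
  moreover have "?ii \<Longrightarrow> ?iii"
    using frame_of_orbits_norm_le_1 frame_of_orbits_constant_coeff assms(2) by blast
  moreover have "?iii \<Longrightarrow> ?i"
  proof -
    assume iii: ?iii
    have "AE \<zeta> in torus N. ereal (cmod (\<phi> \<zeta>)) \<le> Linf_norm N \<phi>"
      unfolding Linf_norm_def by (rule esssup_AE)
    hence "AE \<zeta> in torus N. cmod (\<phi> \<zeta>) \<le> 1"
    proof eventually_elim
      case (elim \<zeta>)
      from order_trans[OF elim conjunct1[OF iii]] show ?case by simp
    qed
    thus ?i using Parseval_frame_of_defect_orbits[OF assms(2)] iii by blast
  qed
  ultimately show ?thesis by blast
qed

end
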